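(* Let $n,k,w,\ell,t\ge 1$ be integers with $t = \lfloor \frac{n-k-\ell-w}{2}\rfloor$, let $q=2^n$, let $\boldsymbol{g}$ be an ordered basis of $\mathbb{F}_q/\mathbb{F}_2$, and let $\boldsymbol{H}$ be a fixed parity-check matrix of the Gabidulin code $\operatorname{Gab}_k(\boldsymbol{g})$. Let $(\boldsymbol{k}_{\rm pub},\boldsymbol{k}_{\rm priv})$ be any pair of keys generated by $\mathsf{KeyGen}$. Then, for every $\boldsymbol{P}\in\mathcal{P}_{t,n}$, $$\mathbb{P}_{\boldsymbol{S},\boldsymbol{T},\boldsymbol{y}}\left(\hat{\boldsymbol{P}}\ne\boldsymbol{P} \;\middle|\; \begin{array}{l}\boldsymbol{u}\leftarrow\mathsf{Encrypt}(\boldsymbol{k}_{\rm pub},\boldsymbol{P})\\ \hat{\boldsymbol{P}}\leftarrow\mathsf{Decrypt}(\boldsymbol{k}_{\rm priv},\boldsymbol{u})\end{array}\right)\le 2^{-(n-t-w)},$$ where the probability is over the choices of $\boldsymbol{S},\boldsymbol{T},\boldsymbol{y}$ made by $\mathsf{Encrypt}$, and the event $\hat{\boldsymbol{P}}\neq\boldsymbol{P}$ includes the case where $\mathsf{Decrypt}$ outputs failure.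
   Context: Vectors are row vectors. $\theta:x\mapsto x^2$ is the Frobenius of $\mathbb{F}_q$, and for $\boldsymbol{g}=(g_1,\dots,g_n)$, $\boldsymbol{g}^{[i]} = (g_1^{2^i},\dots,g_n^{2^i})$. For $\boldsymbol{a}\in\mathbb{F}_q^n$, $\operatorname{Ext}_{\boldsymbol{g}}(\boldsymbol{a})\in\mathbb{F}_2^{n\times n}$ is the unique matrix $\boldsymbol{A}$ with $\boldsymbol{a}=\boldsymbol{g}\boldsymbol{A}$; $\operatorname{rk}(\boldsymbol{a}) = \operatorname{rk}_{\mathbb{F}_2}(\operatorname{Ext}_{\boldsymbol{g}}(\boldsymbol{a}))$ (this is the rank metric weight). The Gabidulin code $\operatorname{Gab}_k(\boldsymbol{g})\subseteq\mathbb{F}_q^n$ is the $\mathbb{F}_q$-span of $\boldsymbol{g}^{[0]},\dots,\boldsymbol{g}^{[k-1]}$; it has dimension $k$. A parity-check matrix of it is $\boldsymbol{H}\in\mathbb{F}_q^{(n-k)\times n}$ of full rank with $\operatorname{Gab}_k(\boldsymbol{g}) = \{\boldsymbol{c}\in\mathbb{F}_q^n : \boldsymbol{H}\boldsymbol{c}^\top=\boldsymbol{0}\}$. The $\boldsymbol{g}$-degree $\deg_{\boldsymbol{g}}(\boldsymbol{x})$ of a nonzero $\boldsymbol{x}\in\mathbb{F}_q^n$ is the unique $m\in\{0,\dots,n-1\}$ with $\boldsymbol{x}\in\operatorname{Gab}_{m+1}(\boldsymbol{g})\setminus\operatorname{Gab}_m(\boldsymbol{g})$ (where $\operatorname{Gab}_0(\boldsymbol{g})=\{\boldsymbol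 0\}$); for a matrix $\boldsymbol{M}\in\mathbb{F}_2^{n\times n}$, $\deg_{\boldsymbol{g}}(\boldsymbol{M}) = \deg_{\boldsymbol{g}}(\boldsymbol{g}\boldsymbol{M})$. $\mathcal{P}_{t,n}$ is the set of matrices in $\mathbb{F}_2^{n\times n}$ of rank $t$ in reduced row echelon form (RREF). For $\boldsymbol{e}\in\mathbb{F}_q^n$, $V_{\boldsymbol{e}}$ is the minimum vanishing polynomial of $\boldsymbol{e}$: the unique monic linearized polynomial $V_{\boldsymbol{e}}(x)=\sum_i v_i x^{2^i}$ over $\mathbb{F}_q$ whose $2$-degree (largest $i$ with $v_i\neq 0$) is minimal among nonzero linearized polynomials vanishing at all coordinates of $\boldsymbol{e}$. Its $2$-degree is $\operatorname{rk}(\boldsymbol{e})$. It is applied to vectors coordinatewise. Algorithms (public parameters $n,k,w,\ell,t,\boldsymbol{g},\boldsymbol{H}$): $\mathsf{KeyGen}$: pick $\boldsymbol{k}_{\rm priv}$ uniformly at random among vectors of $\mathbb{F}_q^n$ of rank $w$; let $\boldsymbol{k}_{\rm pub}\in\mathbb{F}_q^{n-k}$ with $\boldsymbol{k}_{\rm pub}^\top = \boldsymbol{H}\boldsymbol{k}_{\rm priv}^\top$; output $(\boldsymbol{k}_{\rm pub},\boldsymbol{k}_{\rm priv})$. $\mathsf{Encrypt}(\boldsymbol{k}_{\rm pub},\boldsymbol{P})$, $\boldsymbol{P}\in\mathcal{P}_{t,n}$: compute any $\boldsymbol{y}\in\mathbb{F}_q^n$ with $\boldsymbol{H}\boldsymbol{y}^\top=\boldsymbol{k}_{\rm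 pub}^\top$; pick $\boldsymbol{T}$ uniformly at random in $\{\boldsymbol{M}\in\mathbb{F}_2^{n\times n} : \deg_{\boldsymbol{g}}(\boldsymbol{M})=\ell\}$; pick $\boldsymbol{S}$ uniformly at random among invertible matrices of $\mathbb{F}_2^{n\times n}$ (the choices of $\boldsymbol{y},\boldsymbol{T},\boldsymbol{S}$ being independent); compute $\boldsymbol{p}'=\boldsymbol{g}\boldsymbol{S}\boldsymbol{P}\in\mathbb{F}_q^n$; output $\boldsymbol{u}\in\mathbb{F}_q^{n-k}$ with $\boldsymbol{u}^\top = \boldsymbol{H}(\boldsymbol{y}\boldsymbol{T}+\boldsymbol{p}')^\top$. $\mathsf{Decrypt}(\boldsymbol{k}_{\rm priv},\boldsymbol{u})$: compute a solution $\boldsymbol{x}\in\mathbb{F}_q^n$ of $\boldsymbol{H}\boldsymbol{x}^\top=\boldsymbol{u}^\top$; compute $\boldsymbol{z}=V_{\boldsymbol{k}_{\rm priv}}(\boldsymbol{x})$; decode $\boldsymbol{z}$ as a corrupted codeword of $\operatorname{Gab}_{k+\ell+w}(\boldsymbol{g})$ with a decoder correcting every error of rank at most $t$ (i.e. whenever $\boldsymbol{z}=\boldsymbol{c}+\boldsymbol{a}$ with $\boldsymbol{c}\in\operatorname{Gab}_{k+\ell+w}(\boldsymbol{g})$ and $\operatorname{rk}(\boldsymbol{a})\le t$, it returns the error vector $\boldsymbol{a}$, which is unique since the code has minimum rank distance $n-k-\ell-w+1>2t$); if decoding fails or $\operatorname{rk}(\boldsymbol{a})<t$, output failure; otherwise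 output $\hat{\boldsymbol{P}}$, the RREF of $\operatorname{Ext}_{\boldsymbol{g}}(\boldsymbol{a})$. *)

theory Defs
  imports
    "HOL-Probability.Probability_Mass_Function"
    "HOL-Library.Z2"
    "HOL-Computational_Algebra.Polynomial"
    "Jordan_Normal_Form.Gauss_Jordan_Elimination"
    "Jordan_Normal_Form.Matrix_Kernel"
    "Jordan_Normal_Form.DL_Rank"
begin

text \<open>
  The field with two elements is the type \<^typ>\<open>bit\<close>, and the extension field is a finite
  field type \<open>'a\<close> with \<open>CARD('a) = 2 ^ n\<close>. The prime field is embedded by \<open>of_bit\<close>, which sends
  0 to 0 and 1 to 1. The length \<open>n\<close> is recovered as \<open>dim_vec g\<close>.
\<close>

definition F2_scale :: "bit \<Rightarrow> 'a::field \<Rightarrow> 'a" where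
  "F2_scale b x = of_bit b * x"

lemma vector_space_F2_scale:
  assumes "(1::'a::field) + 1 = 0"
  shows "vector_space (F2_scale :: bit \<Rightarrow> 'a \<Rightarrow> 'a)"
proof
  fix a b :: bit and x y :: 'a
  have xx: "x + x = 0"
    using assms by (metis distrib_left mult.right_neutral mult_zero_right)
  show "F2_scale a (x + y) = F2_scale a x + F2_scale a y"
    by (simp add: F2_scale_def algebra_simps)
  show "F2_scale (a + b) x = F2_scale a x + F2_scale b x"
    using xx by (cases a; cases b) (simp_all add: F2_scale_def)
  show "F2_scale a (F2_scale b x) = F2_scale (a * b) x"
    by (simp add: F2_scale_def)
  show "F2_scale 1 x = x"
    by (simp add: F2_scale_def)
qed

definition ordered_basis :: "nat \<Rightarrow> 'a::field vec \<Rightarrow> bool" where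
  "ordered_basis n g \<longleftrightarrow>
     g \<in> carrier_vec n \<and> inj_on (($) g) {..<n} \<and>
     \<not> Modules.module.dependent F2_scale (($) g ` {..<n}) \<and>
     Modules.module.span F2_scale (($) g ` {..<n}) = UNIV"

text \<open>The product of a row vector over \<open>'a\<close> with a binary matrix, \<open>x A = (A\<^sup>T x\<^sup>T)\<^sup>T\<close>.\<close>

definition vec_mult_F2 :: "'a::field vec \<Rightarrow> bit mat \<Rightarrow> 'a vec" (infixl \<open>\<cdot>\<^sub>2\<close> 70) where
  "x \<cdot>\<^sub>2 A = transpose_mat (map_mat of_bit A) *\<^sub>v x"

definition Ext :: "'a::field vec \<Rightarrow> 'a vec \<Rightarrow> bit mat" where
  "Ext g a = (THE A. A \<in> carrier_mat (dim_vec g) (dim_vec g) \<and> a = g \<cdot>\<^sub>2 A)"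

definition rk :: "'a::field vec \<Rightarrow> 'a vec \<Rightarrow> nat" where
  "rk g a = vec_space.rank (dim_vec g) (Ext g a)"

definition frob_vec :: "nat \<Rightarrow> 'a::field vec \<Rightarrow> 'a vec" where
  "frob_vec i g = map_vec (\<lambda>x. x ^ (2 ^ i)) g"

definition Gab :: "nat \<Rightarrow> 'a::field vec \<Rightarrow> 'a vec set" where
  "Gab k g = LinearCombinations.module.span class_ring (module_vec TYPE('a) (dim_vec g))
     ((\<lambda>i. frob_vec i g) ` {..<k})"

definition parity_check :: "nat \<Rightarrow> nat \<Rightarrow> 'a::field vec \<Rightarrow> 'a mat \<Rightarrow> bool" where
  "parity_check n k g H \<longleftrightarrow>
     H \<in> carrier_mat (n - k) n \<and> vec_space.rank (n - k) H = n - k \<and> Gab k g = mat_kernel H"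

text \<open>The degree of the zero vector is unspecified.\<close>

definition gdeg :: "'a::field vec \<Rightarrow> 'a vec \<Rightarrow> nat" where
  "gdeg g x = (THE m. m < dim_vec g \<and> x \<in> Gab (m + 1) g - Gab m g)"

definition mats_of_gdeg :: "'a::field vec \<Rightarrow> nat \<Rightarrow> bit mat set" where
  "mats_of_gdeg g l =
     {M \<in> carrier_mat (dim_vec g) (dim_vec g).
        g \<cdot>\<^sub>2 M \<noteq> 0\<^sub>v (dim_vec g) \<and> gdeg g (g \<cdot>\<^sub>2 M) = l}"

text \<open>The predicate \<^const>\<open>row_echelon_form\<close> already means the \<^emph>\<open>reduced\<close> row echelon form.\<close>

definition RREF_mats :: "nat \<Rightarrow> nat \<Rightarrow> bit mat set" where
  "RREF_mats t n = {P \<in> carrier_mat n n. row_echelon_form P \<and> vec_space.rank n P = t}"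

definition linearized :: "'a::field poly \<Rightarrow> bool" where
  "linearized p \<longleftrightarrow> (\<forall>m. coeff p m \<noteq> 0 \<longrightarrow> (\<exists>i. m = 2 ^ i))"

definition two_degree :: "'a::field poly \<Rightarrow> nat" where
  "two_degree p = Max {i. coeff p (2 ^ i) \<noteq> 0}"

definition vanishes_on :: "'a::field poly \<Rightarrow> 'a vec \<Rightarrow> bool" where
  "vanishes_on p e \<longleftrightarrow> (\<forall>i<dim_vec e. poly p (e $ i) = 0)"

definition min_vanishing_poly :: "'a::field vec \<Rightarrow> 'a poly" where
  "min_vanishing_poly e = (THE V.
     linearized V \<and> lead_coeff V = 1 \<and> vanishes_on V e \<and>
     (\<forall>p. linearized p \<and> p \<noteq> 0 \<and> vanishes_on p e \<longrightarrow> two_degree V \<le> two_degree p))"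

definition KeyGen :: "'a::{field,finite} vec \<Rightarrow> 'a mat \<Rightarrow> nat \<Rightarrow> ('a vec \<times> 'a vec) pmf" where
  "KeyGen g H w = do {
     kpriv \<leftarrow> pmf_of_set {e \<in> carrier_vec (dim_vec g). rk g e = w};
     return_pmf (H *\<^sub>v kpriv, kpriv)
   }"

text \<open>
  An arbitrary, possibly randomised way \<open>Y\<close> of computing a solution \<open>y\<close> of \<open>H y\<^sup>T = s\<^sup>T\<close>, and
  an arbitrary deterministic one.
\<close>

definition solution_sampler :: "'a::field mat \<Rightarrow> ('a vec \<Rightarrow> 'a vec pmf) \<Rightarrow> bool" where
  "solution_sampler H Y \<longleftrightarrow>
     (\<forall>s \<in> carrier_vec (dim_row H).
        set_pmf (Y s) \<subseteq> {y \<in> carrier_vec (dim_col H). H *\<^sub>v y = s})"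

definition solver :: "'a::field mat \<Rightarrow> ('a vec \<Rightarrow> 'a vec) \<Rightarrow> bool" where
  "solver H X \<longleftrightarrow>
     (\<forall>s \<in> carrier_vec (dim_row H). X s \<in> carrier_vec (dim_col H) \<and> H *\<^sub>v X s = s)"

definition Encrypt ::
  "'a::{field,finite} vec \<Rightarrow> 'a mat \<Rightarrow> nat \<Rightarrow> ('a vec \<Rightarrow> 'a vec pmf)
    \<Rightarrow> 'a vec \<Rightarrow> bit mat \<Rightarrow> 'a vec pmf" where
  "Encrypt g H l Y kpub P = do {
     y \<leftarrow> Y kpub;
     T \<leftarrow> pmf_of_set (mats_of_gdeg g l);
     S \<leftarrow> pmf_of_set {S \<in> carrier_mat (dim_vec g) (dim_vec g). invertible_mat S};
     let p' = g \<cdot>\<^sub>2 (S * P);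
     return_pmf (H *\<^sub>v (y \<cdot>\<^sub>2 T + p'))
   }"

text \<open>
  A decoder returns the error vector, or \<^const>\<open>None\<close> for a decoding failure. Its behaviour on
  words that are not within rank distance \<open>t\<close> of the code is arbitrary.
\<close>

definition corrects_errors ::
  "'a::field vec \<Rightarrow> 'a vec set \<Rightarrow> nat \<Rightarrow> ('a vec \<Rightarrow> 'a vec option) \<Rightarrow> bool" where
  "corrects_errors g C t D \<longleftrightarrow>
     (\<forall>c \<in> C. \<forall>a \<in> carrier_vec (dim_vec g). rk g a \<le> t \<longrightarrow> D (c + a) = Some a)"

definition Decrypt ::
  "'a::field vec \<Rightarrow> nat \<Rightarrow> ('a vec \<Rightarrow> 'a vec) \<Rightarrow> ('a vec \<Rightarrow> 'a vec option)
    \<Rightarrow> 'a vec \<Rightarrow> 'a vec \<Rightarrow> bit mat option" where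
  "Decrypt g t X D kpriv u =
     (let x = X u; z = map_vec (poly (min_vanishing_poly kpriv)) x in
      case D z of
        None \<Rightarrow> None
      | Some a \<Rightarrow> if rk g a < t then None else Some (gauss_jordan_single (Ext g a)))"

end

theory Submission
  imports Defs
begin

text \<open>
  Let \<open>V\<close> be the minimum vanishing polynomial of the private key \<open>e\<close> and \<open>M\<close> the binary matrix with
  \<open>V(g) = g M\<close>. Since \<open>V\<close> is linear over the prime field, it commutes with binary matrices, so
  \<open>V(e T) = V(e) T = 0\<close> and \<open>V(g S P) = g M S P\<close>. Every other contribution to \<open>V(x)\<close> is a
  composition of linearized polynomials whose degrees add up to less than \<open>k + l + w\<close>. Hence
  \<open>V(x)\<close> is a codeword plus \<open>g M S P\<close>, and decryption returns \<open>P\<close> as soon as \<open>M\<close> is injective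
  on the image of \<open>S P\<close>, for then \<open>M S P\<close> has rank \<open>t\<close> and the same kernel as \<open>P\<close>.
  The kernel of \<open>M\<close> has at most \<open>2\<^sup>w\<close> elements, the roots of \<open>V\<close>, and \<open>S\<close> maps each nonzero vector
  to a uniformly distributed nonzero vector. The union bound over the nonzero vectors in the image
  of \<open>P\<close> bounds the failure probability by \<open>(2\<^sup>t - 1) (2\<^sup>w - 1) / (2\<^sup>n - 1)\<close>.
\<close>

unbundle no vec_syntax

subsection \<open>Binary matrices acting on vectors over the extension field\<close>

text \<open>Adding 1 permutes the field, so the sum of all its elements absorbs
  \<open>of_nat CARD('a)\<close>; hence 2^n, and with it 2, is zero in the field.\<close>

lemma char_2:
  assumes "CARD('a::{field,finite}) = 2 ^ n"
  shows "(1::'a) + 1 = 0"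
proof -
  have "(\<Sum>x\<in>UNIV. x) = (\<Sum>x\<in>UNIV. x + (1::'a))"
    by (rule sum.reindex_bij_witness[of _ "\<lambda>x. x + 1" "\<lambda>x. x - 1"]) auto
  then have "of_nat CARD('a) = (0::'a)"
    by (simp add: sum.distrib)
  then show ?thesis
    using assms by simp
qed

section \<open>Counting vectors and matrices over finite fields\<close>

lemma carrier_vec_image:
  "(carrier_vec n :: 'a vec set) = Matrix.vec n ` ({..<n} \<rightarrow>\<^sub>E UNIV)"
proof (rule subset_antisym)
  show "(carrier_vec n :: 'a vec set) \<subseteq> Matrix.vec n ` ({..<n} \<rightarrow>\<^sub>E UNIV)"
  proof
    fix v :: "'a vec"
    assume "v \<in> carrier_vec n"
    then have "Matrix.vec n (restrict (($) v) {..<n}) = v"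
      by (intro eq_vecI) auto
    moreover have "restrict (($) v) {..<n} \<in> {..<n} \<rightarrow>\<^sub>E UNIV"
      by simp
    ultimately show "v \<in> Matrix.vec n ` ({..<n} \<rightarrow>\<^sub>E UNIV)"
      by (metis imageI)
  qed
  show "Matrix.vec n ` ({..<n} \<rightarrow>\<^sub>E UNIV) \<subseteq> (carrier_vec n :: 'a vec set)"
    by (rule image_subsetI) (rule vec_carrier)
qed

lemma finite_carrier_vec [simp]: "finite (carrier_vec n :: 'a::finite vec set)"
  unfolding carrier_vec_image by (intro finite_imageI finite_PiE) auto

lemma card_carrier_vec: "card (carrier_vec n :: 'a::finite vec set) = CARD('a) ^ n"
proof -
  have "inj_on (Matrix.vec n) ({..<n} \<rightarrow>\<^sub>E (UNIV :: 'a set))"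
  proof (rule inj_onI)
    fix c d :: "nat \<Rightarrow> 'a"
    assume cd: "c \<in> {..<n} \<rightarrow>\<^sub>E UNIV" "d \<in> {..<n} \<rightarrow>\<^sub>E UNIV"
      and eq: "Matrix.vec n c = Matrix.vec n d"
    have "c i = d i" if "i < n" for i
      using arg_cong[OF eq, of "\<lambda>v. v $ i"] that by simp
    then show "c = d"
      using cd by (intro PiE_ext) auto
  qed
  then show ?thesis
    by (simp add: carrier_vec_image card_image card_PiE)
qed

lemma finite_carrier_mat [simp]: "finite (carrier_mat m n :: 'a::finite mat set)"
proof (rule finite_subset)
  let ?F = "({..<m} \<times> {..<n}) \<rightarrow>\<^sub>E (UNIV :: 'a set)"
  show "carrier_mat m n \<subseteq> Matrix.mat m n ` ?F"
  proof
    fix M :: "'a mat"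
    assume "M \<in> carrier_mat m n"
    then have "Matrix.mat m n (restrict (($$) M) ({..<m} \<times> {..<n})) = M"
      by (intro eq_matI) auto
    moreover have "restrict (($$) M) ({..<m} \<times> {..<n}) \<in> ?F"
      by simp
    ultimately show "M \<in> Matrix.mat m n ` ?F"
      by (metis imageI)
  qed
  show "finite (Matrix.mat m n ` ?F)"
    by (intro finite_imageI finite_PiE) auto
qed

lemma UNIV_bit: "(UNIV :: bit set) = {0, 1}"
  using bit_not_one_iff by auto

instance bit :: finite
  by standard (simp add: UNIV_bit)

lemma CARD_bit: "CARD(bit) = 2"
  unfolding UNIV_bit by simp

text \<open>The row \<open>x\<close> times a single binary column. For a basis \<open>g\<close> it
  is the coordinate isomorphism, which turns statements about field elements into statements about
  binary vectors.\<close>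

definition F2_comb :: "'a::field vec \<Rightarrow> bit vec \<Rightarrow> 'a" where
  "F2_comb x v = (\<Sum>i<dim_vec x. F2_scale (v $ i) (x $ i))"

lemma dim_vec_mult_F2 [simp]: "dim_vec (x \<cdot>\<^sub>2 A) = dim_col A"
  by (simp add: vec_mult_F2_def)

lemma vec_mult_F2_carrier [simp]:
  "A \<in> carrier_mat m n \<Longrightarrow> x \<cdot>\<^sub>2 A \<in> carrier_vec n"
  by (rule carrier_vecI) simp

lemma vec_mult_F2_index:
  assumes "A \<in> carrier_mat (dim_vec x) m" "j < m"
  shows "(x \<cdot>\<^sub>2 A) $ j = F2_comb x (col A j)"
  using assms
  by (auto simp: vec_mult_F2_def F2_comb_def F2_scale_def scalar_prod_def lessThan_atLeast0 intro!: sum.cong)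

text \<open>The only scalars of the prime field are 0 and 1, so an additive map is already linear
  over it.\<close>

lemma additive_F2_comb:
  assumes "Modules.additive f"
  shows "f (F2_comb x v) = F2_comb (map_vec f x) v"
proof -
  interpret Modules.additive f by fact
  have "f (F2_scale b y) = F2_scale b (f y)" for b y
    by (cases b) (simp_all add: zero F2_scale_def)
  then show ?thesis
    by (simp add: F2_comb_def sum)
qed

text \<open>This is what lets the vanishing polynomial pass the binary matrix \<open>T\<close> and
  reach the private key.\<close>

lemma map_vec_vec_mult_F2:
  assumes "Modules.additive f" "A \<in> carrier_mat (dim_vec x) m"
  shows "map_vec f (x \<cdot>\<^sub>2 A) = map_vec f x \<cdot>\<^sub>2 A"
  using assms by (intro eq_vecI) (auto simp: vec_mult_F2_index additive_F2_comb)

lemma zero_vec_mult_F2: "A \<in> carrier_mat m n \<Longrightarrow> 0\<^sub>v m \<cdot>\<^sub>2 A = 0\<^sub>v n"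
  by (intro eq_vecI) (auto simp: vec_mult_F2_index F2_comb_def F2_scale_def)

lemma add_vec_mult_F2:
  assumes "x \<in> carrier_vec m" "y \<in> carrier_vec m" "A \<in> carrier_mat m n"
  shows "(x + y) \<cdot>\<^sub>2 A = x \<cdot>\<^sub>2 A + y \<cdot>\<^sub>2 A"
  using assms unfolding vec_mult_F2_def
  by (intro mult_add_distrib_mat_vec) auto

context
  assumes char2: "(1::'a::field) + 1 = 0"
begin

interpretation F2: vector_space "F2_scale :: bit \<Rightarrow> 'a \<Rightarrow> 'a"
  by (rule vector_space_F2_scale[OF char2])

text \<open>Exchanging the two sums gives associativity of row, matrix and column; it links kernels
  of binary matrices to zeros in the field.\<close>

lemma F2_comb_vec_mult_F2:
  fixes x :: "'a vec"
  assumes A: "A \<in> carrier_mat (dim_vec x) m" and v: "v \<in> carrier_vec m"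
  shows "F2_comb (x \<cdot>\<^sub>2 A) v = F2_comb x (A *\<^sub>v v)"
proof -
  have "F2_comb (x \<cdot>\<^sub>2 A) v
      = (\<Sum>j<m. \<Sum>i<dim_vec x. F2_scale (A $$ (i, j) * v $ j) (x $ i))"
    using A v
    by (auto simp: F2_comb_def vec_mult_F2_index F2.scale_sum_right mult.commute intro!: sum.cong)
  also have "\<dots> = (\<Sum>i<dim_vec x. \<Sum>j<m. F2_scale (A $$ (i, j) * v $ j) (x $ i))"
    by (rule sum.swap)
  also have "\<dots> = (\<Sum>i<dim_vec x. F2_scale ((A *\<^sub>v v) $ i) (x $ i))"
  proof (intro sum.cong refl)
    fix i
    assume "i \<in> {..<dim_vec x}"
    then have "(A *\<^sub>v v) $ i = (\<Sum>j<m. A $$ (i, j) * v $ j)"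
      using A v by (auto simp: scalar_prod_def lessThan_atLeast0 intro!: sum.cong)
    then show "(\<Sum>j<m. F2_scale (A $$ (i, j) * v $ j) (x $ i)) = F2_scale ((A *\<^sub>v v) $ i) (x $ i)"
      by (simp only: F2.scale_sum_left)
  qed
  finally show ?thesis
    by (simp only: F2_comb_def)
qed

lemma vec_mult_F2_assoc:
  fixes x :: "'a vec"
  assumes "A \<in> carrier_mat (dim_vec x) m" "B \<in> carrier_mat m l"
  shows "x \<cdot>\<^sub>2 A \<cdot>\<^sub>2 B = x \<cdot>\<^sub>2 (A * B)"
proof (rule eq_vecI)
  fix j
  assume "j < dim_vec (x \<cdot>\<^sub>2 (A * B))"
  then have "j < l"
    using assms by simp
  moreover have "A * B \<in> carrier_mat (dim_vec x) l"
    using assms by simp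
  moreover have "F2_comb (x \<cdot>\<^sub>2 A) (col B j) = F2_comb x (col (A * B) j)"
    unfolding col_mult2[OF assms \<open>j < l\<close>]
    using assms by (intro F2_comb_vec_mult_F2) auto
  ultimately show "(x \<cdot>\<^sub>2 A \<cdot>\<^sub>2 B) $ j = (x \<cdot>\<^sub>2 (A * B)) $ j"
    using assms vec_mult_F2_index[of B "x \<cdot>\<^sub>2 A" l j] vec_mult_F2_index[of "A * B" x l j]
    by simp
qed (use assms in auto)

lemma frobenius_add: "(x + y) ^ 2 ^ i = (x ^ 2 ^ i + y ^ 2 ^ i :: 'a)"
proof (induction i)
  case (Suc i)
  have "(2 :: 'a) = 0"
    using char2 by simp
  then have sq: "(a + b)\<^sup>2 = a\<^sup>2 + b\<^sup>2" for a b :: 'a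
    by (simp add: power2_sum)
  have "z ^ 2 ^ Suc i = (z ^ 2 ^ i)\<^sup>2" for z :: 'a
    by (simp add: mult.commute flip: power_mult)
  then show ?case
    by (metis Suc sq)
qed simp

end

subsection \<open>Linearized polynomials and Gabidulin codes\<close>

text \<open>Evaluation maps of linearized polynomials of 2-degree below \<open>k\<close>. Taking
  functions instead of polynomials makes composition plain \<open>\<circ>\<close> and evaluation at
  \<open>g\<close> plain \<open>map_vec\<close>.\<close>

definition lin_maps :: "nat \<Rightarrow> ('a::field \<Rightarrow> 'a) set" where
  "lin_maps k = {f. \<exists>c. \<forall>x. f x = (\<Sum>i<k. c i * x ^ 2 ^ i)}"

lemma lin_mapsI: "(\<And>x. f x = (\<Sum>i<k. c i * x ^ 2 ^ i)) \<Longrightarrow> f \<in> lin_maps k"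
  by (auto simp: lin_maps_def)

lemma lin_mapsE:
  assumes "f \<in> lin_maps k"
  obtains c where "\<And>x. f x = (\<Sum>i<k. c i * x ^ 2 ^ i)"
  using assms by (auto simp: lin_maps_def)

lemma lin_maps_mono:
  assumes "k \<le> l"
  shows "lin_maps k \<subseteq> lin_maps l"
proof
  fix f :: "'a \<Rightarrow> 'a"
  assume "f \<in> lin_maps k"
  then obtain c where c: "\<And>x. f x = (\<Sum>i<k. c i * x ^ 2 ^ i)"
    by (rule lin_mapsE) blast
  show "f \<in> lin_maps l"
  proof (rule lin_mapsI)
    fix x
    show "f x = (\<Sum>i<l. (if i < k then c i else 0) * x ^ 2 ^ i)"
      unfolding c using assms by (intro sum.mono_neutral_cong_left) auto
  qed
qed

lemma lin_maps_zero: "(\<lambda>x. 0) \<in> lin_maps k"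
  by (rule lin_mapsI[where c = "\<lambda>_. 0"]) simp

lemma lin_maps_add:
  assumes "f \<in> lin_maps k" "h \<in> lin_maps k"
  shows "(\<lambda>x. f x + h x) \<in> lin_maps k"
proof -
  from assms obtain c d where
    "\<And>x. f x = (\<Sum>i<k. c i * x ^ 2 ^ i)" "\<And>x. h x = (\<Sum>i<k. d i * x ^ 2 ^ i)"
    by (metis lin_mapsE)
  then show ?thesis
    by (intro lin_mapsI[where c = "\<lambda>i. c i + d i"]) (simp add: sum.distrib algebra_simps)
qed

lemma lin_maps_scale:
  assumes "f \<in> lin_maps k"
  shows "(\<lambda>x. a * f x) \<in> lin_maps k"
proof -
  from assms obtain c where "\<And>x. f x = (\<Sum>i<k. c i * x ^ 2 ^ i)"
    by (rule lin_mapsE) blast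
  then show ?thesis
    by (intro lin_mapsI[where c = "\<lambda>i. a * c i"]) (simp add: sum_distrib_left algebra_simps)
qed

lemma lin_maps_sum:
  assumes "\<And>i. i \<in> I \<Longrightarrow> f i \<in> lin_maps k"
  shows "(\<lambda>x. \<Sum>i\<in>I. f i x) \<in> lin_maps k"
  using assms
  by (induction I rule: infinite_finite_induct) (auto intro: lin_maps_zero lin_maps_add)

lemma frobenius_in_lin_maps:
  assumes "i < k"
  shows "(\<lambda>x. x ^ 2 ^ i) \<in> lin_maps k"
proof (rule lin_mapsI)
  fix x :: 'a
  have "(\<Sum>j<k. (if j = i then 1 else 0) * x ^ 2 ^ j) = (\<Sum>j<k. if j = i then x ^ 2 ^ i else 0)"
    by (intro sum.cong) auto
  then show "x ^ 2 ^ i = (\<Sum>j<k. (if j = i then 1 else 0) * x ^ 2 ^ j)"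
    using assms by simp
qed

context
  assumes char2: "(1::'a::field) + 1 = 0"
begin

lemma additive_lin_maps:
  assumes "f \<in> lin_maps k"
  shows "Modules.additive (f :: 'a \<Rightarrow> 'a)"
proof -
  from assms obtain c where "\<And>x. f x = (\<Sum>i<k. c i * x ^ 2 ^ i)"
    by (rule lin_mapsE) blast
  then show ?thesis
    by unfold_locales (simp add: frobenius_add[OF char2] distrib_left sum.distrib)
qed

text \<open>The Frobenius power distributes over the sum, twists the coefficients to
  \<open>c j ^ 2 ^ i\<close> and shifts the index of every term by \<open>i\<close>.\<close>

lemma lin_maps_frobenius:
  assumes "(f :: 'a \<Rightarrow> 'a) \<in> lin_maps k"
  shows "(\<lambda>x. f x ^ 2 ^ i) \<in> lin_maps (k + i)"
proof -
  from assms obtain c where c: "\<And>x. f x = (\<Sum>i<k. c i * x ^ 2 ^ i)"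
    by (rule lin_mapsE) blast
  interpret frob: Modules.additive "\<lambda>x::'a. x ^ 2 ^ i"
    by unfold_locales (rule frobenius_add[OF char2])
  have "(\<lambda>x. f x ^ 2 ^ i) = (\<lambda>x. \<Sum>j<k. c j ^ 2 ^ i * x ^ 2 ^ (j + i))"
    by (simp add: c frob.sum power_mult_distrib power_add flip: power_mult)
  also have "\<dots> \<in> lin_maps (k + i)"
    by (intro lin_maps_sum lin_maps_scale frobenius_in_lin_maps) simp
  finally show ?thesis .
qed

text \<open>2-degrees add under composition. The shape \<open>Suc k\<close> records that
  \<open>f\<close> has 2-degree at most \<open>k\<close>, so even its top term keeps the result
  below \<open>k + l\<close>.\<close>

lemma lin_maps_comp:
  assumes f: "(f :: 'a \<Rightarrow> 'a) \<in> lin_maps (Suc k)" and h: "h \<in> lin_maps l"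
  shows "f \<circ> h \<in> lin_maps (k + l)"
proof -
  from f obtain c where c: "\<And>x. f x = (\<Sum>i<Suc k. c i * x ^ 2 ^ i)"
    by (rule lin_mapsE) blast
  have "(\<lambda>x. h x ^ 2 ^ i) \<in> lin_maps (k + l)" if "i < Suc k" for i
    using lin_maps_frobenius[OF h, of i] lin_maps_mono[of "l + i" "k + l"] that by auto
  then have "(\<lambda>x. \<Sum>i<Suc k. c i * h x ^ 2 ^ i) \<in> lin_maps (k + l)"
    by (intro lin_maps_sum lin_maps_scale) simp
  then show ?thesis
    by (simp add: c comp_def)
qed

end

text \<open>Reads the span as an evaluation code, so that sums and compositions of codewords are
  computed on maps. One inclusion holds because the evaluations form a submodule containing the
  generators, the other by adding one term at a time.\<close>

lemma Gab_eq: "Gab k g = (\<lambda>f. map_vec f g) ` lin_maps k"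
proof -
  define n where "n = dim_vec g"
  interpret vec_space "TYPE('a)" n .
  let ?G = "(\<lambda>i. frob_vec i g) ` {..<k}" and ?R = "(\<lambda>f. map_vec f g) ` lin_maps k"
  have frob: "frob_vec i g \<in> carrier_vec n" for i
    by (rule carrier_vecI) (simp add: frob_vec_def n_def)
  have "span ?G \<subseteq> ?R"
  proof (rule span_is_subset)
    show "?G \<subseteq> ?R"
      by (auto simp: frob_vec_def intro!: imageI frobenius_in_lin_maps)
    show "submodule class_ring ?R V"
    proof (intro submodule.intro)
      have "?R \<subseteq> carrier_vec n"
        by (auto simp: n_def)
      then show "?R \<subseteq> carrier V"
        by simp
      have "0\<^sub>v n \<in> ?R"
        by (rule image_eqI[OF _ lin_maps_zero]) (auto simp: n_def)
      then show "\<zero>\<^bsub>V\<^esub> \<in> ?R"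
        by simp
      show "v \<oplus>\<^bsub>V\<^esub> w \<in> ?R" if "v \<in> ?R" "w \<in> ?R" for v w
      proof -
        from that obtain f h where "f \<in> lin_maps k" "v = map_vec f g" "h \<in> lin_maps k" "w = map_vec h g"
          by auto
        then show ?thesis
          by (intro image_eqI[OF _ lin_maps_add[of f k h]]) auto
      qed
      show "c \<odot>\<^bsub>V\<^esub> v \<in> ?R" if "v \<in> ?R" for c v
      proof -
        from that obtain f where "f \<in> lin_maps k" "v = map_vec f g"
          by auto
        then show ?thesis
          by (intro image_eqI[OF _ lin_maps_scale[of f k c]]) auto
      qed
    qed (rule module_axioms)
  qed
  moreover have "?R \<subseteq> span ?G"
  proof
    fix v
    assume "v \<in> ?R"
    then obtain f where f: "f \<in> lin_maps k" "v = map_vec f g"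
      by auto
    from f(1) obtain c where "f = (\<lambda>x. \<Sum>i<k. c i * x ^ 2 ^ i)"
      by (auto simp: lin_maps_def)
    then have v: "v = map_vec (\<lambda>x. \<Sum>i<k. c i * x ^ 2 ^ i) g"
      using f(2) by simp
    \<comment> \<open>\<open>m\<close> counts the terms added so far and runs up to
      \<open>k\<close>, so that the spanning set stays fixed during the induction.\<close>
    have "map_vec (\<lambda>x. \<Sum>i<m. c i * x ^ 2 ^ i) g \<in> span ?G" if "m \<le> k" for m
      using that
    proof (induction m)
      case 0
      have "lincomb (\<lambda>_. 0) {} = 0\<^sub>v n"
        by (simp add: lincomb_def)
      moreover have "map_vec (\<lambda>x. \<Sum>i<0. c i * x ^ 2 ^ i) g = 0\<^sub>v n"
        by (auto simp: n_def)
      ultimately have "map_vec (\<lambda>x. \<Sum>i<0. c i * x ^ 2 ^ i) g = lincomb (\<lambda>_. 0) {}"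
        by simp
      then show ?case
        by (rule in_spanI) auto
    next
      case (Suc m)
      have "map_vec (\<lambda>x. \<Sum>i<Suc m. c i * x ^ 2 ^ i) g
          = map_vec (\<lambda>x. \<Sum>i<m. c i * x ^ 2 ^ i) g + c m \<cdot>\<^sub>v frob_vec m g"
        by (auto simp: frob_vec_def)
      moreover have "frob_vec m g \<in> span ?G"
        using frob Suc.prems by (intro span_mem) auto
      ultimately show ?case
        using Suc frob by (auto intro!: span_add1 smult_in_span)
    qed
    then show "v \<in> span ?G"
      using v by simp
  qed
  ultimately show ?thesis
    by (auto simp: Gab_def n_def)
qed

subsection \<open>Rank and reduced row echelon forms\<close>

text \<open>The columns of \<open>B\<close> are a maximal independent set of columns of
  \<open>A\<close>: maximality preserves the column space and independence makes \<open>B\<close>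
  injective.\<close>

lemma (in vec_space) rank_factor:
  assumes A: "A \<in> carrier_mat n nc"
  obtains B where "B \<in> carrier_mat n (rank A)"
    and "inj_on ((*\<^sub>v) B) (carrier_vec (rank A))"
    and "(*\<^sub>v) B ` carrier_vec (rank A) = (*\<^sub>v) A ` carrier_vec nc"
proof -
  have cols: "set (cols A) \<subseteq> carrier_vec n"
    using A cols_dim by blast
  obtain S where S: "finite S" "maximal S (\<lambda>T. T \<subseteq> set (cols A) \<and> lin_indpt T)"
    using maximal_exists_superset[of "set (cols A)" "\<lambda>T. T \<subseteq> set (cols A) \<and> lin_indpt T" "{}"]
      finite_lin_indpt2[of "{}"] by auto
  then have sub: "S \<subseteq> set (cols A)" and indpt: "lin_indpt S"
    by (auto simp: maximal_def)
  obtain xs where xs: "set xs = S" "distinct xs"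
    using finite_distinct_list[OF S(1)] by auto
  have len: "length xs = rank A"
    using rank_card_indpt[OF A S(2)] distinct_card[OF xs(2)] xs(1) by simp
  define B where "B = mat_of_cols n xs"
  have B: "B \<in> carrier_mat n (rank A)"
    by (simp add: B_def flip: len)
  have cols_B: "cols B = xs"
    using xs(1) sub cols by (auto simp: B_def)
  have "set (cols A) \<subseteq> span S"
  proof
    fix c
    assume c: "c \<in> set (cols A)"
    show "c \<in> span S"
    proof (cases "c \<in> S")
      case True
      then show ?thesis
        using sub cols by (intro span_mem) auto
    next
      case False
      then have "lin_dep (S \<union> {c})"
        using S(2) sub c unfolding maximal_def by blast
      then show ?thesis
        using lin_dep_iff_in_span[of S c] False indpt sub cols c by auto
    qed
  qed
  then have "span (set (cols A)) \<subseteq> span S"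
    using sub cols by (intro span_subsetI) auto
  then have "col_space B = col_space A"
    using span_is_monotone[OF sub] by (simp add: col_space_def cols_B xs(1))
  moreover have "col_space M = (*\<^sub>v) M ` carrier_vec m" if "M \<in> carrier_mat n m" for M m
    using col_space_eq[OF that] that by auto
  ultimately have "(*\<^sub>v) B ` carrier_vec (rank A) = (*\<^sub>v) A ` carrier_vec nc"
    using A B by metis
  moreover have "inj_on ((*\<^sub>v) B) (carrier_vec (rank A))"
  proof (rule inj_onI, rule ccontr)
    fix v w
    assume v: "v \<in> carrier_vec (rank A)" and w: "w \<in> carrier_vec (rank A)"
      and eq: "B *\<^sub>v v = B *\<^sub>v w" and "v \<noteq> w"
    have "v - w \<noteq> 0\<^sub>v (rank A)"
    proof
      assume "v - w = 0\<^sub>v (rank A)"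
      then have "(v - w) $ i = 0" if "i < rank A" for i
        using that by simp
      then have "v = w"
        using v w by (intro eq_vecI) auto
      then show False
        using \<open>v \<noteq> w\<close> by simp
    qed
    moreover have "B *\<^sub>v (v - w) = 0\<^sub>v n"
      using mult_minus_distrib_mat_vec[OF B v w] B w eq by auto
    ultimately have "lin_dep (set (cols B))"
      using lin_depI[OF B minus_carrier_vec[OF v w]] xs(2) by (auto simp: cols_B)
    then show False
      using indpt cols_B xs(1) by simp
  qed
  ultimately show thesis
    using that B by blast
qed

text \<open>Allows ranks to be compared below by bijections between ranges; the injective factor
  from \<open>rank_factor\<close> does the count.\<close>

lemma card_range_mat:
  fixes A :: "'a::{field,finite} mat"
  assumes "A \<in> carrier_mat n m"
  shows "card ((*\<^sub>v) A ` carrier_vec m) = CARD('a) ^ vec_space.rank n A"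
proof -
  obtain B where inj: "inj_on ((*\<^sub>v) B) (carrier_vec (vec_space.rank n A))"
    and range: "(*\<^sub>v) B ` carrier_vec (vec_space.rank n A) = (*\<^sub>v) A ` carrier_vec m"
    by (rule vec_space.rank_factor[OF assms])
  show ?thesis
    unfolding range[symmetric] card_image[OF inj] by (rule card_carrier_vec)
qed

text \<open>\<open>pivot_fun\<close> relates consecutive rows only; induction reaches all later
  rows. The value \<open>nc\<close> marks a zero row.\<close>

lemma pivot_fun_mono:
  assumes "pivot_fun A f nc" "i < i'" "i' < dim_row A"
  shows "f i < f i' \<or> f i' = nc"
  using assms(2,3)
proof (induction i' rule: less_induct)
  case (less j)
  note D = pivot_funD[OF refl assms(1)]
  obtain j' where j: "j = Suc j'"
    using less.prems by (cases j) auto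
  show ?case
  proof (cases "i = j'")
    case True
    then show ?thesis
      using D(3)[of j'] j less.prems by auto
  next
    case False
    then have "f i < f j' \<or> f j' = nc"
      using less.IH[of j'] less.prems j by auto
    moreover have "f j' < f j \<or> f j = nc" "f j \<le> nc"
      using D(3)[of j'] D(1)[of j] less.prems j by auto
    ultimately show ?thesis
      by auto
  qed
qed

text \<open>A column of an echelon form without pivot is a combination of earlier pivot columns;
  the relation lies in the kernel, hence carries over to any matrix with the same kernel.\<close>

lemma row_echelon_col_eq:
  fixes A B :: "'a::field mat"
  assumes A: "A \<in> carrier_mat m n" and B: "B \<in> carrier_mat m n"
    and f: "pivot_fun A f n"
    and ker: "\<And>v. v \<in> carrier_vec n \<Longrightarrow> A *\<^sub>v v = 0\<^sub>v m \<Longrightarrow> B *\<^sub>v v = 0\<^sub>v m"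
    and eq: "\<And>j i. j < c \<Longrightarrow> i < m \<Longrightarrow> A $$ (i, j) = B $$ (i, j)"
    and c: "c < n" and nonpivot: "\<And>i. i < m \<Longrightarrow> f i \<noteq> c" and r: "r < m"
  shows "A $$ (r, c) = B $$ (r, c)"
proof -
  note D = pivot_funD[OF carrier_matD(1)[OF A] f]
  define I where "I = {i. i < m \<and> f i < c}"
  \<comment> \<open>The relation expressing column \<open>c\<close>: coefficient 1 at
    \<open>c\<close> and \<open>- A $$ (i, c)\<close> at the pivot position \<open>f i\<close> of
    each row in \<open>I\<close>.\<close>
  define v where "v = unit_vec n c - Matrix.vec n (\<lambda>j. \<Sum>i\<in>I. if j = f i then A $$ (i, c) else 0)"
  have fin: "finite I"
    by (simp add: I_def)
  have v: "v \<in> carrier_vec n"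
    by (simp add: v_def)
  have M: "(M *\<^sub>v v) $ s = M $$ (s, c) - (\<Sum>i\<in>I. A $$ (i, c) * M $$ (s, f i))"
    if "M \<in> carrier_mat m n" "s < m" for M :: "'a mat" and s
  proof -
    have "(M *\<^sub>v v) $ s = row M s \<bullet> unit_vec n c
        - row M s \<bullet> Matrix.vec n (\<lambda>j. \<Sum>i\<in>I. if j = f i then A $$ (i, c) else 0)"
      using that by (simp add: v_def scalar_prod_minus_distrib[of _ n])
    moreover have "row M s \<bullet> unit_vec n c = M $$ (s, c)"
      using that c by simp
    moreover have "row M s \<bullet> Matrix.vec n (\<lambda>j. \<Sum>i\<in>I. if j = f i then A $$ (i, c) else 0)
        = (\<Sum>j<n. \<Sum>i\<in>I. if j = f i then A $$ (i, c) * M $$ (s, j) else 0)"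
      using that
      by (auto simp: scalar_prod_def lessThan_atLeast0 sum_distrib_left intro!: sum.cong)
    moreover have "\<dots> = (\<Sum>i\<in>I. \<Sum>j<n. if j = f i then A $$ (i, c) * M $$ (s, j) else 0)"
      by (rule sum.swap)
    moreover have "\<dots> = (\<Sum>i\<in>I. A $$ (i, c) * M $$ (s, f i))"
      using c by (intro sum.cong refl) (auto simp: I_def)
    ultimately show ?thesis
      by simp
  qed
  have "A *\<^sub>v v = 0\<^sub>v m"
  proof (rule eq_vecI)
    fix s
    assume "s < dim_vec (0\<^sub>v m :: 'a vec)"
    then have s: "s < m"
      by simp
    \<comment> \<open>Pivot columns are unit columns, so only the term \<open>i = s\<close>
      survives. If \<open>s\<close> is not in \<open>I\<close>, its pivot lies right of
      \<open>c\<close> because \<open>c\<close> is no pivot column, and \<open>A $$ (s, c)\<close>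
      is 0.\<close>
    have "(\<Sum>i\<in>I. A $$ (i, c) * A $$ (s, f i)) = (\<Sum>i\<in>I. if i = s then A $$ (s, c) else 0)"
      using D(4)[of s] D(5) s c by (intro sum.cong) (auto simp: I_def)
    also have "\<dots> = A $$ (s, c)"
    proof (cases "s \<in> I")
      case False
      then have "c < f s"
        using nonpivot[OF s] s by (auto simp: I_def)
      then show ?thesis
        using False fin D(2)[OF s] by simp
    qed (use fin in simp)
    finally show "(A *\<^sub>v v) $ s = 0\<^sub>v m $ s"
      using M[OF A s] s by simp
  qed (use A in auto)
  then have "B *\<^sub>v v = 0\<^sub>v m"
    by (rule ker[OF v])
  then have "B $$ (r, c) = (\<Sum>i\<in>I. A $$ (i, c) * B $$ (r, f i))"
    using M[OF B r] r by simp
  also have "\<dots> = (\<Sum>i\<in>I. A $$ (i, c) * A $$ (r, f i))"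
    using eq r by (intro sum.cong) (auto simp: I_def)
  also have "\<dots> = A $$ (r, c)"
    using M[OF A r] \<open>A *\<^sub>v v = 0\<^sub>v m\<close> r by simp
  finally show ?thesis ..
qed

text \<open>If \<open>i\<close> came before \<open>i'\<close>, row \<open>i\<close> of
  \<open>B\<close> would have its pivot 1 in a column left of \<open>c\<close>, where the two
  matrices agree; but row \<open>i\<close> of \<open>A\<close> is zero left of its own pivot
  \<open>c\<close>.\<close>

lemma row_echelon_pivot_le:
  fixes A B :: "'a::field mat"
  assumes A: "A \<in> carrier_mat m n" and B: "B \<in> carrier_mat m n"
    and f: "pivot_fun A f n" and h: "pivot_fun B h n"
    and eq: "\<And>j i. j < c \<Longrightarrow> i < m \<Longrightarrow> A $$ (i, j) = B $$ (i, j)"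
    and c: "c < n" and i: "i < m" "f i = c" and i': "i' < m" "h i' = c"
  shows "i' \<le> (i :: nat)"
proof (rule ccontr)
  assume "\<not> i' \<le> i"
  then have "h i < c"
    using pivot_fun_mono[OF h, of i i'] B i' c by auto
  then have "B $$ (i, h i) = 1" "A $$ (i, h i) = 0"
    using pivot_funD(4)[OF carrier_matD(1)[OF B] h] pivot_funD(2)[OF carrier_matD(1)[OF A] f] i c
    by auto
  then show False
    using eq[of "h i" i] \<open>h i < c\<close> i by simp
qed

text \<open>By induction on columns: a column that is no pivot column of one of the matrices is
  handled by \<open>row_echelon_col_eq\<close>, and a common pivot column is the same unit column
  because the pivot rows agree. This identifies the decrypted matrix with \<open>P\<close>.\<close>

lemma row_echelon_form_unique:
  fixes A B :: "'a::field mat"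
  assumes A: "A \<in> carrier_mat m n" "row_echelon_form A"
    and B: "B \<in> carrier_mat m n" "row_echelon_form B"
    and ker: "\<And>v. v \<in> carrier_vec n \<Longrightarrow> A *\<^sub>v v = 0\<^sub>v m \<longleftrightarrow> B *\<^sub>v v = 0\<^sub>v m"
  shows "A = B"
proof -
  obtain f h where f: "pivot_fun A f n" and h: "pivot_fun B h n"
    using A B by (auto simp: row_echelon_form_def)
  have "\<forall>i<m. A $$ (i, c) = B $$ (i, c)" if "c < n" for c
    using that
  proof (induction c rule: less_induct)
    case (less c)
    then have eq: "A $$ (i, j) = B $$ (i, j)" if "j < c" "i < m" for i j
      using that by auto
    show ?case
    proof (intro allI impI)
      fix r
      assume r: "r < m"
      consider "\<And>i. i < m \<Longrightarrow> f i \<noteq> c" | "\<And>i. i < m \<Longrightarrow> h i \<noteq> c"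
        | i i' where "i < m" "f i = c" "i' < m" "h i' = c"
        by blast
      then show "A $$ (r, c) = B $$ (r, c)"
      proof cases
        case 1
        then show ?thesis
          using row_echelon_col_eq[OF A(1) B(1) f _ eq less.prems] ker r by blast
      next
        case 2
        then show ?thesis
          using row_echelon_col_eq[OF B(1) A(1) h _ eq[symmetric] less.prems, of r] ker r by auto
      next
        case 3
        then have "i' \<le> i" "i \<le> i'"
          using row_echelon_pivot_le[OF A(1) B(1) f h eq less.prems]
            row_echelon_pivot_le[OF B(1) A(1) h f eq[symmetric] less.prems] by blast+
        then have i: "i < m" "f i = c" "h i = c"
          using 3 by auto
        show ?thesis
          using i less.prems r pivot_funD(4,5)[OF carrier_matD(1)[OF A(1)] f, of i]
            pivot_funD(4,5)[OF carrier_matD(1)[OF B(1)] h, of i]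
          by (cases "r = i") auto
      qed
    qed
  qed
  then show ?thesis
    using A B by (intro eq_matI) auto
qed

subsection \<open>Minimum vanishing polynomials and the degree\<close>

lemma poly_sum_monom_powers:
  fixes c :: "nat \<Rightarrow> 'a::field" and k :: nat
  defines "p \<equiv> \<Sum>i<k. monom (c i) (2 ^ i)"
  shows "linearized p" "coeff p (2 ^ i) = (if i < k then c i else 0)"
    "poly p x = (\<Sum>i<k. c i * x ^ 2 ^ i)"
proof -
  have coeff: "coeff p m = (\<Sum>i<k. if 2 ^ i = m then c i else 0)" for m
    by (simp add: p_def coeff_sum)
  have "coeff p (2 ^ i) = (\<Sum>j<k. if j = i then c j else 0)"
    unfolding coeff by (intro sum.cong refl if_cong) simp_all
  then show "coeff p (2 ^ i) = (if i < k then c i else 0)"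
    by simp
  show "linearized p"
    unfolding linearized_def
  proof (intro allI impI, rule ccontr)
    fix m
    assume "coeff p m \<noteq> 0" and "\<nexists>i. m = 2 ^ i"
    then have "2 ^ i \<noteq> m" for i
      by blast
    then show False
      using \<open>coeff p m \<noteq> 0\<close> by (simp add: coeff)
  qed
  show "poly p x = (\<Sum>i<k. c i * x ^ 2 ^ i)"
    by (simp add: p_def poly_sum poly_monom)
qed

text \<open>The leading exponent is a power of two, so the 2-degree controls the ordinary degree and
  hence the number of roots.\<close>

lemma linearized_degree:
  assumes "linearized p" "p \<noteq> 0"
  shows "degree p = 2 ^ two_degree p"
proof -
  have "coeff p (degree p) \<noteq> 0"
    using assms(2) by simp
  then obtain d where d: "degree p = 2 ^ d"
    using assms(1) unfolding linearized_def by blast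
  have le: "i \<le> d" if "coeff p (2 ^ i) \<noteq> 0" for i
    using le_degree[OF that] d by simp
  have "coeff p (2 ^ d) \<noteq> 0"
    using assms(2) by (simp flip: d)
  then have "two_degree p = d"
    unfolding two_degree_def using le
    by (intro Max_eqI) (auto intro: finite_subset[of _ "{..d}"])
  then show ?thesis
    using d by simp
qed

lemma linearized_in_lin_maps:
  assumes "linearized p" "p \<noteq> 0"
  shows "poly p \<in> lin_maps (Suc (two_degree p))"
proof (rule lin_mapsI)
  fix x
  let ?d = "two_degree p"
  have "poly p x = (\<Sum>m\<le>2 ^ ?d. coeff p m * x ^ m)"
    by (simp add: poly_altdef linearized_degree[OF assms])
  also have "\<dots> = (\<Sum>m\<in>(^) 2 ` {..<Suc ?d}. coeff p m * x ^ m)"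
  proof (rule sum.mono_neutral_right)
    show "\<forall>m\<in>{..2 ^ ?d} - (^) 2 ` {..<Suc ?d}. coeff p m * x ^ m = 0"
    proof
      fix m :: nat
      assume m: "m \<in> {..2 ^ ?d} - (^) 2 ` {..<Suc ?d}"
      then have "m \<noteq> 2 ^ i" for i
        by (cases "i < Suc ?d") auto
      then show "coeff p m * x ^ m = 0"
        using assms(1) unfolding linearized_def by fastforce
    qed
  qed auto
  also have "\<dots> = (\<Sum>i<Suc ?d. coeff p (2 ^ i) * x ^ 2 ^ i)"
    by (subst sum.reindex) (auto simp: inj_on_def)
  finally show "poly p x = (\<Sum>i<Suc ?d. coeff p (2 ^ i) * x ^ 2 ^ i)" .
qed

text \<open>A nonzero coefficient would give a nonzero polynomial of degree at most 2^(k-1), hence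
  with fewer roots than the field has elements.\<close>

lemma lin_map_zero_coeffs:
  fixes c :: "nat \<Rightarrow> 'a::{field,finite}"
  assumes "\<And>x. (\<Sum>i<k. c i * x ^ 2 ^ i) = 0" "2 ^ k \<le> CARD('a)" "i < k"
  shows "c i = 0"
proof (rule ccontr)
  assume "c i \<noteq> 0"
  define p where "p = (\<Sum>i<k. monom (c i) (2 ^ i))"
  note p = poly_sum_monom_powers[where k = k and c = c, folded p_def]
  have "p \<noteq> 0"
    using \<open>c i \<noteq> 0\<close> p(2)[of i] assms(3) by auto
  have "coeff p (2 ^ two_degree p) \<noteq> 0"
    using linearized_degree[OF p(1) \<open>p \<noteq> 0\<close>] \<open>p \<noteq> 0\<close> by (metis leading_coeff_0_iff)
  then have "two_degree p < k"
    using p(2) by (auto split: if_splits)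
  have "CARD('a) = card {x. poly p x = 0}"
    using assms(1) p(3) by simp
  also have "\<dots> \<le> 2 ^ two_degree p"
    using card_poly_roots_bound[OF \<open>p \<noteq> 0\<close>] linearized_degree[OF p(1) \<open>p \<noteq> 0\<close>] by simp
  also have "\<dots> < 2 ^ k"
    using \<open>two_degree p < k\<close> by simp
  finally show False
    using assms(2) by simp
qed

lemma rank_diag:
  assumes "w \<le> n"
  shows "vec_space.rank n (Matrix.mat n n (\<lambda>(i, j). if i = j \<and> i < w then 1 else 0) :: bit mat) = w"
    (is "vec_space.rank n ?D = w")
proof -
  \<comment> \<open>\<open>pad\<close> reads only the first \<open>w\<close> entries, so it has the
    same image on vectors of length \<open>n\<close> and of length \<open>w\<close>. On the latter
    it is injective, which gives 2^w image points.\<close>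
  define pad :: "bit vec \<Rightarrow> bit vec" where "pad u = Matrix.vec n (\<lambda>i. if i < w then u $ i else 0)" for u
  have D: "?D *\<^sub>v v = pad v" if "v \<in> carrier_vec n" for v
  proof (rule eq_vecI)
    fix i
    assume "i < dim_vec (pad v)"
    then have i: "i < n"
      by (simp add: pad_def)
    have "Matrix.row ?D i = (if i < w then unit_vec n i else 0\<^sub>v n)"
      using i by (intro eq_vecI) auto
    then show "(?D *\<^sub>v v) $ i = pad v $ i"
      using i that by (simp add: pad_def)
  qed (simp add: pad_def)
  have "pad ` carrier_vec n = pad ` carrier_vec w"
  proof (intro equalityI image_subsetI)
    fix u :: "bit vec"
    show "pad u \<in> pad ` carrier_vec w"
      by (rule image_eqI[of _ _ "Matrix.vec w (($) u)"]) (auto simp: pad_def)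
    show "pad u \<in> pad ` carrier_vec n"
      by (rule image_eqI[of _ _ "Matrix.vec n (($) u)"]) (auto simp: pad_def)
  qed
  moreover have "inj_on pad (carrier_vec w)"
  proof (rule inj_onI)
    fix u v :: "bit vec"
    assume uv: "u \<in> carrier_vec w" "v \<in> carrier_vec w" and eq: "pad u = pad v"
    have "u $ i = v $ i" if "i < w" for i
      using arg_cong[OF eq, of "\<lambda>x. x $ i"] that assms by (simp add: pad_def)
    then show "u = v"
      using uv by (intro eq_vecI) auto
  qed
  moreover have "(*\<^sub>v) ?D ` carrier_vec n = pad ` carrier_vec n"
    using D by (intro image_cong) auto
  ultimately have "card ((*\<^sub>v) ?D ` carrier_vec n) = 2 ^ w"
    by (simp add: card_image card_carrier_vec CARD_bit)
  then show ?thesis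
    using card_range_mat[of ?D n n] by (simp add: CARD_bit)
qed

section \<open>Coordinates with respect to a basis of the extension field\<close>

locale F2_basis =
  fixes n :: nat and g :: "'a::{field,finite} vec"
  assumes card: "CARD('a) = 2 ^ n" and basis: "ordered_basis n g"
begin

lemma char2: "(1::'a) + 1 = 0"
  by (rule char_2[OF card])

interpretation F2: vector_space "F2_scale :: bit \<Rightarrow> 'a \<Rightarrow> 'a"
  by (rule vector_space_F2_scale[OF char2])

lemma g_carrier [simp]: "g \<in> carrier_vec n"
  using basis by (simp add: ordered_basis_def)

lemma dim_g [simp]: "dim_vec g = n"
  using g_carrier by simp

text \<open>Spanning gives surjectivity, and injectivity follows because both sides have 2^n
  elements.\<close>

lemma bij_F2_comb: "bij_betw (F2_comb g) (carrier_vec n) UNIV"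
proof -
  have "x \<in> F2_comb g ` carrier_vec n" for x
  proof -
    let ?B = "($) g ` {..<n}"
    have "x \<in> F2.span ?B"
      using basis by (simp add: ordered_basis_def)
    then obtain u where "x = (\<Sum>v\<in>?B. F2_scale (u v) v)"
      by (subst (asm) F2.span_finite) auto
    also have "\<dots> = (\<Sum>i<n. F2_scale (u (g $ i)) (g $ i))"
      using basis by (simp add: ordered_basis_def sum.reindex)
    also have "\<dots> = F2_comb g (Matrix.vec n (\<lambda>i. u (g $ i)))"
      by (simp add: F2_comb_def)
    finally show ?thesis
      by (rule image_eqI) (rule vec_carrier)
  qed
  then have surj: "F2_comb g ` carrier_vec n = UNIV"
    by blast
  moreover have "inj_on (F2_comb g) (carrier_vec n)"
    using surj card by (intro eq_card_imp_inj_on) (simp_all add: card_carrier_vec CARD_bit)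
  ultimately show ?thesis
    by (simp add: bij_betw_def)
qed

text \<open>Column \<open>j\<close> must be the coordinate vector of \<open>a $ j\<close>. This
  justifies the definite description in \<open>Ext\<close>.\<close>

lemma ex1_matrix:
  assumes "a \<in> carrier_vec n"
  shows "\<exists>!A. A \<in> carrier_mat n n \<and> a = g \<cdot>\<^sub>2 A"
proof -
  define v where "v x = inv_into (carrier_vec n) (F2_comb g) x" for x
  have v: "F2_comb g (v x) = x" "v x \<in> carrier_vec n" for x
    using bij_F2_comb f_inv_into_f[of x "F2_comb g"] inv_into_into[of x "F2_comb g"]
    by (auto simp: v_def bij_betw_def)
  define A where "A = Matrix.mat n n (\<lambda>(i, j). v (a $ j) $ i)"
  have "col A j = v (a $ j)" if "j < n" for j
    using that v(2)[of "a $ j"] by (intro eq_vecI) (auto simp: A_def)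
  then have "a = g \<cdot>\<^sub>2 A"
    using assms v(1) by (intro eq_vecI) (auto simp: A_def vec_mult_F2_index[of _ _ n])
  moreover have "A \<in> carrier_mat n n"
    by (simp add: A_def)
  moreover have "B = C" if B: "B \<in> carrier_mat n n" and C: "C \<in> carrier_mat n n"
    and eq: "g \<cdot>\<^sub>2 B = g \<cdot>\<^sub>2 C" for B C
  proof (rule mat_col_eqI)
    fix j
    assume "j < dim_col C"
    then have j: "j < n"
      using C by simp
    then have "F2_comb g (col B j) = F2_comb g (col C j)"
      using B C vec_mult_F2_index[of _ g n j] eq by (metis dim_g)
    then show "col B j = col C j"
      using bij_F2_comb B C j by (auto simp: bij_betw_def inj_on_def)
  qed (use B C in auto)
  ultimately show ?thesis
    by metis
qed

lemma Ext:
  assumes "a \<in> carrier_vec n"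
  shows "Ext g a \<in> carrier_mat n n" "g \<cdot>\<^sub>2 Ext g a = a"
  using theI'[OF ex1_matrix[OF assms]] by (simp_all add: Ext_def)

lemma Ext_vec_mult_F2: "A \<in> carrier_mat n n \<Longrightarrow> Ext g (g \<cdot>\<^sub>2 A) = A"
  unfolding Ext_def by (rule the1_equality) (auto intro!: ex1_matrix)

text \<open>Ensures that \<open>KeyGen\<close> draws from a nonempty set, so that its uniform
  distribution is genuine.\<close>

lemma ex_rk:
  assumes "w \<le> n"
  shows "\<exists>e \<in> carrier_vec n. rk g e = w"
proof -
  let ?D = "Matrix.mat n n (\<lambda>(i, j). if i = j \<and> i < w then 1 else 0) :: bit mat"
  have D: "?D \<in> carrier_mat n n"
    by simp
  have "rk g (g \<cdot>\<^sub>2 ?D) = w"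
    unfolding rk_def dim_g Ext_vec_mult_F2[OF D] by (rule rank_diag[OF assms])
  then show ?thesis
    by (rule bexI) (rule vec_mult_F2_carrier[OF D])
qed

lemma lin_map_eq_on_basis:
  assumes "f \<in> lin_maps k" "map_vec f g = 0\<^sub>v n"
  shows "f x = 0"
proof -
  obtain v where v: "x = F2_comb g v"
    using bij_F2_comb by (auto simp: bij_betw_def image_iff)
  have "f x = F2_comb (map_vec f g) v"
    unfolding v by (rule additive_F2_comb[OF additive_lin_maps[OF char2 assms(1)]])
  then show ?thesis
    by (simp add: assms(2) F2_comb_def F2_scale_def)
qed

text \<open>The difference of two coefficient sequences with equal values on the basis gives a map
  that vanishes everywhere; its 2-degree below \<open>n\<close> then forces all coefficients to be
  zero.\<close>

lemma inj_on_Gab_coeffs: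
  "inj_on (\<lambda>c. map_vec (\<lambda>x. \<Sum>i<n. c i * x ^ 2 ^ i) g) ({..<n} \<rightarrow>\<^sub>E UNIV)"
proof (rule inj_onI)
  fix c d :: "nat \<Rightarrow> 'a"
  assume cd: "c \<in> {..<n} \<rightarrow>\<^sub>E UNIV" "d \<in> {..<n} \<rightarrow>\<^sub>E UNIV"
    and eq: "map_vec (\<lambda>x. \<Sum>i<n. c i * x ^ 2 ^ i) g = map_vec (\<lambda>x. \<Sum>i<n. d i * x ^ 2 ^ i) g"
  let ?f = "\<lambda>x. \<Sum>i<n. (c i - d i) * x ^ 2 ^ i"
  have "?f (g $ j) = 0" if "j < n" for j
    using arg_cong[OF eq, of "\<lambda>v. v $ j"] that by (simp add: left_diff_distrib sum_subtractf)
  then have "map_vec ?f g = 0\<^sub>v n"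
    by (intro eq_vecI) auto
  moreover have "?f \<in> lin_maps n"
    by (rule lin_mapsI) simp
  ultimately have "?f x = 0" for x
    by (intro lin_map_eq_on_basis)
  then have "c i - d i = 0" if "i < n" for i
    using lin_map_zero_coeffs[where k = n and c = "\<lambda>i. c i - d i" and i = i] card that by simp
  then show "c = d"
    using cd by (intro PiE_ext) auto
qed

section \<open>The chain of Gabidulin codes and the degree\<close>

lemma Gab_mono: "k \<le> m \<Longrightarrow> Gab k g \<subseteq> Gab m g"
  unfolding Gab_eq using lin_maps_mono by blast

lemma Gab_carrier: "Gab k g \<subseteq> carrier_vec n"
  using g_carrier by (auto simp: Gab_eq)

text \<open>Distinct coefficient sequences of length \<open>n\<close> give distinct codewords, as
  many as there are vectors. Hence every nonzero vector has a degree.\<close>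

lemma Gab_n: "Gab n g = carrier_vec n"
proof (rule card_subset_eq)
  let ?F = "\<lambda>c. map_vec (\<lambda>x. \<Sum>i<n. c i * x ^ 2 ^ i) g"
  have "?F ` ({..<n} \<rightarrow>\<^sub>E UNIV) \<subseteq> Gab n g"
    by (auto simp: Gab_eq intro!: imageI lin_mapsI)
  then have "card (?F ` ({..<n} \<rightarrow>\<^sub>E UNIV)) \<le> card (Gab n g)"
    by (rule card_mono[OF finite_subset[OF Gab_carrier finite_carrier_vec]])
  then have "card (carrier_vec n :: 'a vec set) \<le> card (Gab n g)"
    unfolding card_image[OF inj_on_Gab_coeffs] card_carrier_vec by (simp add: card_PiE)
  then show "card (Gab n g) = card (carrier_vec n :: 'a vec set)"
    using card_mono[OF finite_carrier_vec Gab_carrier[of n]] by (rule antisym[rotated])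
qed (simp_all add: Gab_carrier)

lemma gdeg_unique:
  assumes "x \<in> Gab (a + 1) g - Gab a g" "x \<in> Gab (b + 1) g - Gab b g"
  shows "a = b"
  using assms Gab_mono[of "a + 1" b] Gab_mono[of "b + 1" a] by (cases a b rule: linorder_cases) auto

lemma gdeg_Gab:
  assumes "x \<in> carrier_vec n" "x \<noteq> 0\<^sub>v n"
  shows "x \<in> Gab (gdeg g x + 1) g"
proof -
  \<comment> \<open>The degree is one less than the least index whose code contains
    \<open>x\<close>; that index is positive because \<open>Gab 0 g\<close> contains only
    zero.\<close>
  define m where "m = (LEAST m. x \<in> Gab m g)"
  have "x \<in> Gab n g"
    using assms(1) Gab_n by simp
  then have m: "x \<in> Gab m g" "m \<le> n"
    unfolding m_def by (rule LeastI, rule Least_le)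
  have "m \<noteq> 0"
    using m(1) assms(2) by (auto simp: Gab_eq elim!: lin_mapsE)
  then obtain m' where m': "m = Suc m'"
    by (cases m) auto
  then have "x \<notin> Gab m' g"
    using not_less_Least[of m' "\<lambda>m. x \<in> Gab m g"] by (simp add: m_def)
  then have m_prop: "m' < dim_vec g \<and> x \<in> Gab (m' + 1) g - Gab m' g"
    using m m' by simp
  then have "gdeg g x = m'"
    unfolding gdeg_def using gdeg_unique by (intro the_equality) blast+
  then show ?thesis
    using m_prop by simp
qed

lemma mats_of_gdeg_Gab:
  assumes "T \<in> mats_of_gdeg g l"
  shows "T \<in> carrier_mat n n" "g \<cdot>\<^sub>2 T \<in> Gab (l + 1) g"
proof -
  have T: "T \<in> carrier_mat n n" "g \<cdot>\<^sub>2 T \<noteq> 0\<^sub>v n" "gdeg g (g \<cdot>\<^sub>2 T) = l"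
    using assms by (simp_all add: mats_of_gdeg_def)
  show "T \<in> carrier_mat n n"
    by (rule T)
  show "g \<cdot>\<^sub>2 T \<in> Gab (l + 1) g"
    using gdeg_Gab[OF vec_mult_F2_carrier[OF T(1)] T(2)] unfolding T(3) .
qed

text \<open>The \<open>l\<close>-th Frobenius power of \<open>g\<close> has degree exactly
  \<open>l\<close>. Consequently \<open>Encrypt\<close> draws \<open>T\<close> from a nonempty
  set.\<close>

lemma mats_of_gdeg_nonempty:
  assumes "l < n"
  shows "mats_of_gdeg g l \<noteq> {}"
proof -
  let ?x = "map_vec (\<lambda>x. x ^ 2 ^ l) g"
  have in_Gab: "?x \<in> Gab (l + 1) g"
    by (auto simp: Gab_eq intro!: imageI frobenius_in_lin_maps)
  have "?x \<notin> Gab l g"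
  proof
    assume "?x \<in> Gab l g"
    then obtain f where f: "f \<in> lin_maps l" "?x = map_vec f g"
      unfolding Gab_eq by auto
    from f(1) obtain c where "f = (\<lambda>x. \<Sum>i<l. c i * x ^ 2 ^ i)"
      by (auto simp: lin_maps_def)
    then have c: "?x = map_vec (\<lambda>x. \<Sum>i<l. c i * x ^ 2 ^ i) g"
      using f(2) by simp
    \<comment> \<open>Moving the assumed combination of lower powers to one side leaves coefficient
      1 at \<open>l\<close>. The resulting map vanishes on the basis, hence everywhere, although its
      degree is below the field size.\<close>
    define d where "d = (\<lambda>i. if i = l then 1 else - c i)"
    have d: "(\<Sum>i<Suc l. d i * x ^ 2 ^ i) = x ^ 2 ^ l - (\<Sum>i<l. c i * x ^ 2 ^ i)" for x
      by (simp add: d_def sum_negf)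
    have "map_vec (\<lambda>x. \<Sum>i<Suc l. d i * x ^ 2 ^ i) g = 0\<^sub>v n"
    proof (rule eq_vecI)
      fix j
      assume "j < dim_vec (0\<^sub>v n :: 'a vec)"
      then show "map_vec (\<lambda>x. \<Sum>i<Suc l. d i * x ^ 2 ^ i) g $ j = 0\<^sub>v n $ j"
        using arg_cong[OF c, of "\<lambda>v. v $ j"] unfolding d by simp
    qed simp
    moreover have "(\<lambda>x. \<Sum>i<Suc l. d i * x ^ 2 ^ i) \<in> lin_maps (Suc l)"
      by (rule lin_mapsI) (rule refl)
    ultimately have "(\<Sum>i<Suc l. d i * x ^ 2 ^ i) = 0" for x
      using lin_map_eq_on_basis by blast
    moreover have "2 ^ Suc l \<le> CARD('a)"
      unfolding card using assms by (intro power_increasing) auto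
    ultimately have "d l = 0"
      by (rule lin_map_zero_coeffs) simp
    then show False
      by (simp add: d_def)
  qed
  moreover have "0\<^sub>v n \<in> Gab l g"
    unfolding Gab_eq by (rule image_eqI[OF _ lin_maps_zero]) auto
  ultimately have "?x \<noteq> 0\<^sub>v n"
    by auto
  moreover have "gdeg g ?x = l"
    unfolding gdeg_def using in_Gab \<open>?x \<notin> Gab l g\<close> assms gdeg_unique
    by (intro the_equality) auto
  moreover obtain T where "T \<in> carrier_mat n n" "?x = g \<cdot>\<^sub>2 T"
    using Ext[of ?x] by (metis g_carrier map_carrier_vec)
  ultimately have "T \<in> mats_of_gdeg g l"
    by (simp add: mats_of_gdeg_def)
  then show ?thesis
    by auto
qed

text \<open>By pigeonhole: \<open>w + 1\<close> free coefficients meet only \<open>w\<close>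
  conditions, since all entries of \<open>e\<close> are binary combinations of \<open>w\<close>
  field elements.\<close>

lemma ex_vanishing_poly:
  assumes "e \<in> carrier_vec n" "rk g e = w"
  obtains p where "linearized p" "p \<noteq> 0" "vanishes_on p e" "two_degree p \<le> w"
proof -
  let ?A = "Ext g e"
  have A: "?A \<in> carrier_mat n n"
    by (rule Ext[OF assms(1)])
  have w: "vec_space.rank n ?A = w"
    using assms(2) by (simp add: rk_def)
  obtain B where B: "B \<in> carrier_mat n w"
    and range: "(*\<^sub>v) B ` carrier_vec w = (*\<^sub>v) ?A ` carrier_vec n"
    by (rule vec_space.rank_factor[OF A, unfolded w])
  \<comment> \<open>The \<open>w\<close> entries of \<open>y\<close> generate the entries of
    \<open>e\<close> over the prime field, as \<open>B\<close> has the same range as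
    \<open>Ext g e\<close>.\<close>
  define y where "y = g \<cdot>\<^sub>2 B"
  define F where "F c = (\<lambda>j\<in>{..<w}. \<Sum>i<Suc w. c i * (y $ j) ^ 2 ^ i)" for c
  have "\<not> inj_on F ({..<Suc w} \<rightarrow>\<^sub>E UNIV)"
  proof
    assume "inj_on F ({..<Suc w} \<rightarrow>\<^sub>E UNIV)"
    then have "card ({..<Suc w} \<rightarrow>\<^sub>E (UNIV :: 'a set)) \<le> card ({..<w} \<rightarrow>\<^sub>E (UNIV :: 'a set))"
      by (rule card_inj_on_le) (auto simp: F_def intro!: finite_PiE)
    then have "CARD('a) ^ Suc w \<le> CARD('a) ^ w"
      by (simp add: card_PiE)
    moreover have "1 < CARD('a)"
      using card_mono[of UNIV "{0, 1 :: 'a}"] by simp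
    ultimately show False
      by (simp add: power_increasing_iff)
  qed
  then obtain c d where cd: "c \<in> {..<Suc w} \<rightarrow>\<^sub>E UNIV" "d \<in> {..<Suc w} \<rightarrow>\<^sub>E UNIV"
    and "c \<noteq> d" and eq: "F c = F d"
    by (auto simp: inj_on_def)
  then obtain k where k: "k < Suc w" "c k \<noteq> d k"
    using PiE_ext[OF cd] by auto
  \<comment> \<open>Two different sequences with equal values on \<open>y\<close> differ by the
    coefficients of a nonzero linearized polynomial that vanishes on \<open>y\<close>.\<close>
  define p where "p = (\<Sum>i<Suc w. monom (c i - d i) (2 ^ i))"
  note p = poly_sum_monom_powers[where k = "Suc w" and c = "\<lambda>i. c i - d i", folded p_def]
  have "p \<noteq> 0"
    using p(2)[of k] k by auto
  have "poly p (y $ j) = 0" if "j < w" for j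
    using fun_cong[OF eq, of j] that unfolding p(3) F_def
    by (simp add: left_diff_distrib sum_subtractf)
  then have y0: "map_vec (poly p) y = 0\<^sub>v w"
    using B by (intro eq_vecI) (auto simp: y_def)
  have "poly p (e $ j) = 0" if j: "j < n" for j
  proof -
    have "col ?A j = ?A *\<^sub>v unit_vec n j"
      by (intro eq_vecI) (use A j in auto)
    then have "col ?A j \<in> (*\<^sub>v) B ` carrier_vec w"
      unfolding range by (rule image_eqI) simp
    then obtain v where v: "v \<in> carrier_vec w" "col ?A j = B *\<^sub>v v"
      by (rule imageE) blast
    have "e $ j = F2_comb g (col ?A j)"
      using vec_mult_F2_index[of ?A g n j] A j Ext(2)[OF assms(1)] by simp
    also have "\<dots> = F2_comb y v"
      unfolding y_def using B v by (simp add: F2_comb_vec_mult_F2[OF char2, of B g w v])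
    finally have "poly p (e $ j) = F2_comb (map_vec (poly p) y) v"
      using additive_F2_comb[OF additive_lin_maps[OF char2 linearized_in_lin_maps[OF p(1) \<open>p \<noteq> 0\<close>]]]
      by simp
    then show ?thesis
      by (simp add: y0 F2_comb_def F2_scale_def)
  qed
  then have "vanishes_on p e"
    using assms(1) by (simp add: vanishes_on_def)
  moreover have "two_degree p \<le> w"
  proof -
    have "coeff p (2 ^ two_degree p) \<noteq> 0"
      using linearized_degree[OF p(1) \<open>p \<noteq> 0\<close>] \<open>p \<noteq> 0\<close> by (metis leading_coeff_0_iff)
    then show ?thesis
      using p(2)[of "two_degree p"] by (auto split: if_splits)
  qed
  ultimately show thesis
    using that p(1) \<open>p \<noteq> 0\<close> by blast
qed

text \<open>Resolves the definite description: existence comes from normalizing a competitor of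
  least 2-degree, uniqueness from the cancelling leading terms of two candidates, and the bound
  \<open>w\<close> from comparison with \<open>ex_vanishing_poly\<close>.\<close>

lemma min_vanishing_poly:
  assumes "e \<in> carrier_vec n" "rk g e = w"
  defines "V \<equiv> min_vanishing_poly e"
  shows "linearized V" "V \<noteq> 0" "vanishes_on V e" "two_degree V \<le> w"
proof -
  \<comment> \<open>\<open>Q\<close> describes the competitors, \<open>R\<close> the property inside
    the definite description.\<close>
  define Q where "Q p \<longleftrightarrow> linearized p \<and> p \<noteq> 0 \<and> vanishes_on p e" for p
  define R where "R W \<longleftrightarrow> linearized W \<and> lead_coeff W = 1 \<and> vanishes_on W e \<and>
     (\<forall>p. linearized p \<and> p \<noteq> 0 \<and> vanishes_on p e \<longrightarrow> two_degree W \<le> two_degree p)" for W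
  obtain p where p: "Q p" "two_degree p \<le> w"
    using ex_vanishing_poly[OF assms(1,2)] unfolding Q_def by metis
  obtain m where m: "Q m" "\<And>p. Q p \<Longrightarrow> two_degree m \<le> two_degree p"
    using ex_has_least_nat[of Q p two_degree] p(1) by blast
  define W where "W = Polynomial.smult (inverse (lead_coeff m)) m"
  have lc: "lead_coeff m \<noteq> 0"
    using m(1) by (simp add: Q_def)
  then have "two_degree W = two_degree m"
    by (simp add: two_degree_def W_def)
  then have "R W"
    using m lc unfolding R_def Q_def W_def
    by (auto simp: linearized_def vanishes_on_def)
  have RQ: "Q W'" if "R W'" for W'
    using that by (auto simp: R_def Q_def)
  have unique: "W' = W''" if "R W'" "R W''" for W' W''
  proof (rule ccontr)
    assume ne: "W' \<noteq> W''"
    have "two_degree W' = two_degree W''"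
      using that RQ[OF that(1)] RQ[OF that(2)] unfolding R_def Q_def by (meson le_antisym)
    then have deg: "degree W' = degree W''"
      using RQ[OF that(1)] RQ[OF that(2)] linearized_degree unfolding Q_def by metis
    have lin: "linearized (W' - W'')"
      unfolding linearized_def
    proof (intro allI impI)
      fix i
      assume "coeff (W' - W'') i \<noteq> 0"
      then have "coeff W' i \<noteq> 0 \<or> coeff W'' i \<noteq> 0"
        by auto
      then show "\<exists>j. i = 2 ^ j"
        using that unfolding R_def linearized_def by blast
    qed
    moreover have "vanishes_on (W' - W'') e"
      using that by (simp add: R_def vanishes_on_def)
    \<comment> \<open>Minimality keeps the degree of the difference from dropping, while the two
      leading coefficients 1 cancel.\<close>
    ultimately have "two_degree W' \<le> two_degree (W' - W'')"
      using that(1) ne unfolding R_def by simp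
    then have "degree W' \<le> degree (W' - W'')"
      using linearized_degree[OF lin] ne RQ[OF that(1)] linearized_degree[of W']
      by (simp add: Q_def)
    moreover have "degree (W' - W'') \<le> degree W'"
      using deg by (simp add: degree_diff_le)
    ultimately have "degree (W' - W'') = degree W'"
      by simp
    then have "lead_coeff (W' - W'') = lead_coeff W' - lead_coeff W''"
      using deg by (simp only: coeff_diff)
    also have "\<dots> = 0"
      using that by (simp add: R_def)
    finally show False
      using ne by (simp only: leading_coeff_0_iff right_minus_eq)
  qed
  have "V = (THE W. R W)"
    by (simp add: V_def min_vanishing_poly_def R_def)
  also have "\<dots> = W"
    using \<open>R W\<close> unique by (intro the_equality)
  finally have "R V"
    using \<open>R W\<close> by simp
  then show "linearized V" "V \<noteq> 0" "vanishes_on V e"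
    by (auto simp: R_def)
  show "two_degree V \<le> w"
    using \<open>R V\<close> p unfolding R_def Q_def by (meson le_trans)
qed

end

subsection \<open>Counting invertible matrices\<close>

text \<open>A coordinate where both vectors are 1 gives a unit vector \<open>r\<close>; otherwise
  \<open>r\<close> is the sum of two unit vectors, one at a coordinate where only \<open>v\<close>
  is 1 and one where only \<open>w\<close> is.\<close>

lemma ex_dot_one:
  fixes v w :: "bit vec"
  assumes "v \<in> carrier_vec n" "w \<in> carrier_vec n" "v \<noteq> 0\<^sub>v n" "w \<noteq> 0\<^sub>v n"
  obtains r where "r \<in> carrier_vec n" "r \<bullet> v = 1" "r \<bullet> w = 1"
proof -
  have ex: "\<exists>i<n. x $ i = 1" if x: "x \<in> carrier_vec n" "x \<noteq> 0\<^sub>v n" for x :: "bit vec"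
  proof (rule ccontr)
    assume "\<not> (\<exists>i<n. x $ i = 1)"
    then have "x = 0\<^sub>v n"
      using x(1) by (intro eq_vecI) auto
    then show False
      using x(2) by simp
  qed
  obtain i j where i: "i < n" "v $ i = 1" and j: "j < n" "w $ j = 1"
    using ex[OF assms(1,3)] ex[OF assms(2,4)] by blast
  show thesis
  proof (cases "w $ i = 1 \<or> v $ j = 1")
    case True
    then show thesis
      using that[of "unit_vec n i"] that[of "unit_vec n j"] i j assms(1,2) by auto
  next
    case False
    have "(unit_vec n i + unit_vec n j) \<bullet> x = x $ i + x $ j" if "x \<in> carrier_vec n" for x :: "bit vec"
      using that i j by (simp add: add_scalar_prod_distrib[of _ n])
    then show thesis
      using that[of "unit_vec n i + unit_vec n j"] False i j assms(1,2) by auto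
  qed
qed

text \<open>The witness is the transvection \<open>x \<mapsto> x + (r \<bullet> x) (v + w)\<close> for an \<open>r\<close> with
  \<open>r \<bullet> v = r \<bullet> w = 1\<close>.\<close>

lemma ex_involution:
  fixes v w :: "bit vec"
  assumes v: "v \<in> carrier_vec n" "v \<noteq> 0\<^sub>v n" and w: "w \<in> carrier_vec n" "w \<noteq> 0\<^sub>v n"
  obtains Q where "Q \<in> carrier_mat n n" "Q * Q = 1\<^sub>m n" "Q *\<^sub>v v = w" "Q *\<^sub>v w = v"
proof -
  obtain r where r: "r \<in> carrier_vec n" "r \<bullet> v = 1" "r \<bullet> w = 1"
    using ex_dot_one[of v n w] v w by blast
  \<comment> \<open>\<open>r \<bullet> c\<close> is 1 + 1 = 0, so the transvection fixes
    \<open>c\<close>, and applying it twice adds the same multiple of \<open>c\<close> twice, which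
    is zero.\<close>
  define c where "c = v + w"
  have c: "c \<in> carrier_vec n" "r \<bullet> c = 0"
    using v w r by (simp_all add: c_def scalar_prod_add_distrib[of _ n])
  define Q where "Q = Matrix.mat n n (\<lambda>(i, j). (if i = j then 1 else 0) + c $ i * r $ j)"
  have Q: "Q \<in> carrier_mat n n"
    by (simp add: Q_def)
  have Qx: "Q *\<^sub>v x = x + (r \<bullet> x) \<cdot>\<^sub>v c" if x: "x \<in> carrier_vec n" for x
  proof (rule eq_vecI)
    fix i
    assume "i < dim_vec (x + (r \<bullet> x) \<cdot>\<^sub>v c)"
    then have i: "i < n"
      using c by simp
    have "Matrix.row Q i = unit_vec n i + (c $ i) \<cdot>\<^sub>v r"
      using i r(1) by (intro eq_vecI) (auto simp: Q_def)
    moreover have "(unit_vec n i + (c $ i) \<cdot>\<^sub>v r) \<bullet> x = x $ i + c $ i * (r \<bullet> x)"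
      using i x r(1) by (subst add_scalar_prod_distrib[of _ n]) simp_all
    ultimately show "(Q *\<^sub>v x) $ i = (x + (r \<bullet> x) \<cdot>\<^sub>v c) $ i"
      using Q i x c by (simp only: index_mult_mat_vec index_add_vec index_smult_vec
          carrier_matD carrier_vecD mult.commute)
  qed (use Q c in auto)
  have swap: "Q *\<^sub>v v = w" "Q *\<^sub>v w = v"
    unfolding Qx[OF v(1)] Qx[OF w(1)] r c_def using v w by (auto intro!: eq_vecI)
  have QQ: "Q *\<^sub>v (Q *\<^sub>v x) = x" if x: "x \<in> carrier_vec n" for x
  proof -
    have "r \<bullet> (Q *\<^sub>v x) = r \<bullet> x"
      using Qx[OF x] x c r(1) by (simp add: scalar_prod_add_distrib[of _ n])
    then have "Q *\<^sub>v (Q *\<^sub>v x) = x + (r \<bullet> x) \<cdot>\<^sub>v c + (r \<bullet> x) \<cdot>\<^sub>v c"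
      using Qx[OF x] Qx[of "Q *\<^sub>v x"] x c(1) by simp
    also have "\<dots> = x"
      using x c(1) by (intro eq_vecI) (auto simp: add.assoc)
    finally show ?thesis .
  qed
  have "Q * Q = 1\<^sub>m n"
  proof (rule mat_col_eqI)
    fix j
    assume "j < dim_col (1\<^sub>m n :: bit mat)"
    then have j: "j < n"
      by simp
    have "col Q j = Q *\<^sub>v unit_vec n j"
      by (intro eq_vecI) (use Q j in auto)
    then have "col (Q * Q) j = Q *\<^sub>v (Q *\<^sub>v unit_vec n j)"
      using col_mult2[OF Q Q j] by simp
    also have "\<dots> = unit_vec n j"
      by (rule QQ) simp
    finally show "col (Q * Q) j = col (1\<^sub>m n) j"
      using j by simp
  qed (use Q in auto)
  then show thesis
    using that Q swap by blast
qed

definition GL :: "nat \<Rightarrow> 'a::field mat set" where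
  "GL n = {S \<in> carrier_mat n n. invertible_mat S}"

lemma GL_iff:
  "S \<in> GL n \<longleftrightarrow> S \<in> carrier_mat n n \<and> (\<exists>B \<in> carrier_mat n n. S * B = 1\<^sub>m n \<and> B * S = 1\<^sub>m n)"
proof
  assume "S \<in> GL n"
  then have S: "S \<in> carrier_mat n n" and "invertible_mat S"
    by (auto simp: GL_def)
  then obtain B where B: "S * B = 1\<^sub>m n" "B * S = 1\<^sub>m (dim_row B)"
    unfolding invertible_mat_def inverts_mat_def by auto
  have "dim_col B = n" "dim_row B = n"
    using arg_cong[OF B(1), of dim_col] arg_cong[OF B(2), of dim_col] S by auto
  then show "S \<in> carrier_mat n n \<and> (\<exists>B \<in> carrier_mat n n. S * B = 1\<^sub>m n \<and> B * S = 1\<^sub>m n)"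
    using S B by (intro conjI bexI[of _ B]) auto
next
  assume "S \<in> carrier_mat n n \<and> (\<exists>B \<in> carrier_mat n n. S * B = 1\<^sub>m n \<and> B * S = 1\<^sub>m n)"
  then show "S \<in> GL n"
    unfolding GL_def invertible_mat_def inverts_mat_def by auto
qed

text \<open>The inverse is \<open>B * Q\<close>, as \<open>Q\<close> is its own inverse. Such
  products move between the fibres counted below.\<close>

lemma GL_mult:
  assumes "S \<in> GL n" "Q \<in> carrier_mat n n" "Q * Q = 1\<^sub>m n"
  shows "Q * S \<in> GL n"
proof -
  obtain B where S: "S \<in> carrier_mat n n" and B: "B \<in> carrier_mat n n" "S * B = 1\<^sub>m n" "B * S = 1\<^sub>m n"
    using assms(1) by (auto simp: GL_iff)
  have "S * (B * Q) = Q"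
    using assoc_mult_mat[OF S B(1) assms(2)] B(2) assms(2) by simp
  then have "(Q * S) * (B * Q) = 1\<^sub>m n"
    using assoc_mult_mat[OF assms(2) S, of "B * Q" n] B(1) assms(2,3) by simp
  moreover have "Q * (Q * S) = S"
    using assoc_mult_mat[OF assms(2) assms(2) S] assms(3) S by simp
  then have "(B * Q) * (Q * S) = 1\<^sub>m n"
    using assoc_mult_mat[OF B(1) assms(2), of "Q * S" n] B(3) assms(2) S by simp
  ultimately show ?thesis
    unfolding GL_iff using S B(1) assms(2) by (intro conjI bexI[of _ "B * Q"]) auto
qed

lemma GL_mult_vec_nonzero:
  assumes "S \<in> GL n" "x \<in> carrier_vec n" "x \<noteq> 0\<^sub>v n"
  shows "S *\<^sub>v x \<noteq> 0\<^sub>v n"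
proof
  assume eq: "S *\<^sub>v x = 0\<^sub>v n"
  obtain B where S: "S \<in> carrier_mat n n" and B: "B \<in> carrier_mat n n" "B * S = 1\<^sub>m n"
    using assms(1) by (auto simp: GL_iff)
  have "x = (B * S) *\<^sub>v x"
    using B assms(2) by simp
  also have "\<dots> = B *\<^sub>v (S *\<^sub>v x)"
    by (rule assoc_mult_mat_vec[OF B(1) S assms(2)])
  also have "\<dots> = 0\<^sub>v n"
    unfolding eq using B by auto
  finally show False
    using assms(3) by simp
qed

lemma finite_GL [simp]: "finite (GL n :: 'a::{field,finite} mat set)"
  by (rule finite_subset[OF _ finite_carrier_mat[of n n]]) (auto simp: GL_def)

lemma GL_nonempty: "GL n \<noteq> {}"
proof -
  have "1\<^sub>m n \<in> GL n"
    unfolding GL_iff by (intro conjI bexI[of _ "1\<^sub>m n"]) auto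
  then show ?thesis
    by auto
qed

text \<open>Left multiplication by an involution exchanging two nonzero vectors maps one fibre
  injectively into the other, so the fibres over the 2^n - 1 nonzero vectors have equal size. They
  partition the group because \<open>S *\<^sub>v x\<close> is never zero.\<close>

lemma card_GL_fibre:
  fixes x v :: "bit vec"
  assumes x: "x \<in> carrier_vec n" "x \<noteq> 0\<^sub>v n" and v: "v \<in> carrier_vec n" "v \<noteq> 0\<^sub>v n"
  shows "(2 ^ n - 1) * card {S \<in> GL n. S *\<^sub>v x = v} = card (GL n :: bit mat set)"
proof -
  let ?T = "carrier_vec n - {0\<^sub>v n} :: bit vec set"
  have le: "card {S \<in> GL n. S *\<^sub>v x = u} \<le> card {S \<in> GL n. S *\<^sub>v x = u'}"
    if "u \<in> ?T" "u' \<in> ?T" for u u' :: "bit vec"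
  proof -
    have u: "u \<in> carrier_vec n" "u \<noteq> 0\<^sub>v n" "u' \<in> carrier_vec n" "u' \<noteq> 0\<^sub>v n"
      using that by simp_all
    obtain Q where Q: "Q \<in> carrier_mat n n" "Q * Q = 1\<^sub>m n" "Q *\<^sub>v u = u'" "Q *\<^sub>v u' = u"
      by (rule ex_involution[OF u])
    show ?thesis
    proof (rule card_inj_on_le)
      show "inj_on ((*) Q) {S \<in> GL n. S *\<^sub>v x = u}"
      proof (rule inj_on_inverseI)
        fix S
        assume "S \<in> {S \<in> GL n. S *\<^sub>v x = u}"
        then have "S \<in> carrier_mat n n"
          by (simp add: GL_def)
        then show "Q * (Q * S) = S"
          using assoc_mult_mat[OF Q(1) Q(1), of S n] Q(2) by simp
      qed
      show "(*) Q ` {S \<in> GL n. S *\<^sub>v x = u} \<subseteq> {S \<in> GL n. S *\<^sub>v x = u'}"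
      proof
        fix R
        assume "R \<in> (*) Q ` {S \<in> GL n. S *\<^sub>v x = u}"
        then obtain S where S: "S \<in> GL n" "S *\<^sub>v x = u" "R = Q * S"
          by auto
        then have "S \<in> carrier_mat n n"
          by (simp add: GL_def)
        then have "R *\<^sub>v x = u'"
          using S Q assoc_mult_mat_vec[OF Q(1) _ x(1)] by simp
        then show "R \<in> {S \<in> GL n. S *\<^sub>v x = u'}"
          using S GL_mult[OF S(1) Q(1,2)] by simp
      qed
      show "finite {S \<in> GL n. S *\<^sub>v x = u'}"
        by simp
    qed
  qed
  have "card (GL n :: bit mat set) = (\<Sum>u\<in>?T. card {S \<in> GL n. S *\<^sub>v x = u})"
  proof -
    have "(\<lambda>S. S *\<^sub>v x) ` GL n \<subseteq> ?T"
    proof (rule image_subsetI)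
      fix S :: "bit mat"
      assume S: "S \<in> GL n"
      then have "S \<in> carrier_mat n n"
        by (simp add: GL_def)
      then show "S *\<^sub>v x \<in> ?T"
        using GL_mult_vec_nonzero[OF S x] x(1) by simp
    qed
    then show ?thesis
      using sum.group[of "GL n :: bit mat set" ?T "\<lambda>S. S *\<^sub>v x" "\<lambda>_. 1 :: nat"] by simp
  qed
  also have "\<dots> = (\<Sum>u\<in>?T. card {S \<in> GL n. S *\<^sub>v x = v})"
    using v by (intro sum.cong refl antisym le) auto
  also have "\<dots> = (2 ^ n - 1) * card {S \<in> GL n. S *\<^sub>v x = v}"
    by (simp add: card_Diff_singleton card_carrier_vec CARD_bit)
  finally show ?thesis ..
qed

text \<open>The union bound over pairs \<open>(x, v)\<close>, with the factor
  \<open>2 ^ n - 1\<close> on the left to stay within the natural numbers.\<close>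

lemma card_GL_meets_le:
  fixes X K :: "bit vec set"
  assumes X: "X \<subseteq> carrier_vec n - {0\<^sub>v n}" and K: "K \<subseteq> carrier_vec n - {0\<^sub>v n}"
  shows "(2 ^ n - 1) * card {S \<in> GL n. \<exists>x\<in>X. S *\<^sub>v x \<in> K} \<le> card X * card K * card (GL n :: bit mat set)"
proof -
  have fin: "finite X" "finite K"
    by (rule finite_subset[OF X], simp) (rule finite_subset[OF K], simp)
  have "{S \<in> GL n. \<exists>x\<in>X. S *\<^sub>v x \<in> K} = (\<Union>(x, v)\<in>X \<times> K. {S \<in> GL n. S *\<^sub>v x = v})"
    by auto
  then have "(2 ^ n - 1) * card {S \<in> GL n. \<exists>x\<in>X. S *\<^sub>v x \<in> K}
      \<le> (2 ^ n - 1) * (\<Sum>(x, v)\<in>X \<times> K. card {S \<in> GL n. S *\<^sub>v x = v})"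
    using card_UN_le[of "X \<times> K" "\<lambda>(x, v). {S \<in> GL n. S *\<^sub>v x = v}"] fin
    by (intro mult_left_mono) (auto simp: case_prod_unfold)
  also have "\<dots> = (\<Sum>(x, v)\<in>X \<times> K. card (GL n :: bit mat set))"
    unfolding sum_distrib_left using X K card_GL_fibre[of _ n]
    by (intro sum.cong refl) (clarsimp, blast)
  also have "\<dots> = card X * card K * card (GL n :: bit mat set)"
    using fin by (simp add: case_prod_unfold card_cartesian_product)
  finally show ?thesis .
qed

subsection \<open>Decryption failures\<close>

context F2_basis
begin

text \<open>Coordinates embed the kernel into the roots of the vanishing polynomial, since
  \<open>V\<close> acts on \<open>F2_comb g v\<close> as the matrix acts on \<open>v\<close>; the
  degree bounds the number of roots.\<close>

lemma card_kernel_min_vanishing_poly: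
  assumes "e \<in> carrier_vec n" "rk g e = w"
  defines "V \<equiv> poly (min_vanishing_poly e)"
  shows "card {v \<in> carrier_vec n. Ext g (map_vec V g) *\<^sub>v v = 0\<^sub>v n} \<le> 2 ^ w"
proof -
  let ?V = "min_vanishing_poly e" and ?M = "Ext g (map_vec V g)"
  note V = min_vanishing_poly[OF assms(1,2)]
  have M: "?M \<in> carrier_mat n n" "g \<cdot>\<^sub>2 ?M = map_vec V g"
    by (rule Ext; simp)+
  have add: "Modules.additive V"
    unfolding V_def by (rule additive_lin_maps[OF char2 linearized_in_lin_maps[OF V(1,2)]])
  have "card {v \<in> carrier_vec n. ?M *\<^sub>v v = 0\<^sub>v n} \<le> card {x. poly ?V x = 0}"
  proof (rule card_inj_on_le)
    show "inj_on (F2_comb g) {v \<in> carrier_vec n. ?M *\<^sub>v v = 0\<^sub>v n}"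
      using bij_F2_comb by (auto simp: bij_betw_def intro: inj_on_subset)
    show "F2_comb g ` {v \<in> carrier_vec n. ?M *\<^sub>v v = 0\<^sub>v n} \<subseteq> {x. poly ?V x = 0}"
    proof (rule image_subsetI)
      fix v
      assume "v \<in> {v \<in> carrier_vec n. ?M *\<^sub>v v = 0\<^sub>v n}"
      then have v: "v \<in> carrier_vec n" "?M *\<^sub>v v = 0\<^sub>v n"
        by simp_all
      have "V (F2_comb g v) = F2_comb (g \<cdot>\<^sub>2 ?M) v"
        unfolding M(2) by (rule additive_F2_comb[OF add])
      also have "\<dots> = F2_comb g (?M *\<^sub>v v)"
        using M(1) v(1) by (intro F2_comb_vec_mult_F2[OF char2]) simp_all
      also have "\<dots> = 0"
        by (simp add: v(2) F2_comb_def F2_scale_def)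
      finally show "F2_comb g v \<in> {x. poly ?V x = 0}"
        by (simp add: V_def)
    qed
  qed simp
  also have "\<dots> \<le> 2 ^ two_degree ?V"
    using card_poly_roots_bound[OF V(2)] linearized_degree[OF V(1,2)] by simp
  also have "\<dots> \<le> 2 ^ w"
    using V(4) by simp
  finally show ?thesis .
qed

text \<open>The deterministic half of the argument. The assumption \<open>good\<close> isolates what
  is asked of the random matrix: \<open>S\<close> must move no nonzero vector of the image of
  \<open>P\<close> into the kernel.\<close>

lemma Decrypt_eq:
  assumes k: "1 \<le> k"
    and H: "H \<in> carrier_mat r n" "Gab k g = mat_kernel H"
    and e: "e \<in> carrier_vec n" "rk g e = w"
    and y: "y \<in> carrier_vec n" "H *\<^sub>v y = H *\<^sub>v e"
    and X: "solver H X"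
    and D: "corrects_errors g (Gab (k + l + w) g) t D"
    and P: "P \<in> RREF_mats t n"
    and T: "T \<in> mats_of_gdeg g l"
    and S: "S \<in> carrier_mat n n"
    and good: "\<And>v. v \<in> carrier_vec n \<Longrightarrow> P *\<^sub>v v \<noteq> 0\<^sub>v n \<Longrightarrow>
      Ext g (map_vec (poly (min_vanishing_poly e)) g) *\<^sub>v (S *\<^sub>v (P *\<^sub>v v)) \<noteq> 0\<^sub>v n"
  shows "Decrypt g t X D e (H *\<^sub>v (y \<cdot>\<^sub>2 T + g \<cdot>\<^sub>2 (S * P))) = Some P"
proof -
  define V where "V = poly (min_vanishing_poly e)"
  define M where "M = Ext g (map_vec V g)"
  \<comment> \<open>\<open>g \<cdot>\<^sub>2 N\<close> will be the error that the decoder has to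
    find.\<close>
  define N where "N = M * (S * P)"
  define q where "q = y \<cdot>\<^sub>2 T + g \<cdot>\<^sub>2 (S * P)"
  define x where "x = X (H *\<^sub>v q)"
  note min = min_vanishing_poly[OF e]
  note T = mats_of_gdeg_Gab[OF T]
  have P: "P \<in> carrier_mat n n" "row_echelon_form P" "vec_space.rank n P = t"
    using P by (simp_all add: RREF_mats_def)
  have SP: "S * P \<in> carrier_mat n n"
    by (rule mult_carrier_mat[OF S P(1)])
  have M: "M \<in> carrier_mat n n" "g \<cdot>\<^sub>2 M = map_vec V g"
    unfolding M_def by (rule Ext; simp)+
  have N: "N \<in> carrier_mat n n"
    unfolding N_def by (rule mult_carrier_mat[OF M(1) SP])
  have N_mult: "N *\<^sub>v v = M *\<^sub>v (S *\<^sub>v (P *\<^sub>v v))" if v: "v \<in> carrier_vec n" for v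
    unfolding N_def assoc_mult_mat_vec[OF M(1) SP v] assoc_mult_mat_vec[OF S P(1) v] ..
  have V_lin: "V \<in> lin_maps (Suc w)"
    unfolding V_def using linearized_in_lin_maps[OF min(1,2)] lin_maps_mono min(4)
    by (meson Suc_le_mono subsetD)
  then have V_add: "Modules.additive V"
    by (rule additive_lin_maps[OF char2])
  have q: "q \<in> carrier_vec n"
    unfolding q_def by (intro add_carrier_vec vec_mult_F2_carrier[OF T(1)] vec_mult_F2_carrier[OF SP])
  have x: "x \<in> carrier_vec n" "H *\<^sub>v x = H *\<^sub>v q"
    using X mult_mat_vec_carrier[OF H(1) q] H(1) unfolding solver_def x_def by simp_all
  \<comment> \<open>Two vectors with the same syndrome differ by a codeword, thus by the values at
    \<open>g\<close> of a map in \<open>lin_maps k\<close>. This covers the freedom in choosing both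
    \<open>x\<close> and \<open>y\<close>.\<close>
  have diff: "\<exists>f \<in> lin_maps k. u - v = map_vec f g"
    if "u \<in> carrier_vec n" "v \<in> carrier_vec n" "H *\<^sub>v u = H *\<^sub>v v" for u v
  proof -
    have "H *\<^sub>v (u - v) = H *\<^sub>v v - H *\<^sub>v v"
      unfolding mult_minus_distrib_mat_vec[OF H(1) that(1,2)] that(3) ..
    also have "\<dots> = 0\<^sub>v r"
      by (rule minus_cancel_vec[OF mult_mat_vec_carrier[OF H(1) that(2)]])
    finally have "u - v \<in> Gab k g"
      unfolding H(2) by (rule mat_kernelI[OF H(1) minus_carrier_vec[OF that(1,2)]])
    then show ?thesis
      unfolding Gab_eq by blast
  qed
  obtain a where a: "a \<in> lin_maps k" "x - q = map_vec a g"
    using diff[OF x(1) q x(2)] by blast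
  obtain b where b: "b \<in> lin_maps k" "y - e = map_vec b g"
    using diff[OF y(1) e(1) y(2)] by blast
  obtain s where s: "s \<in> lin_maps (l + 1)" "g \<cdot>\<^sub>2 T = map_vec s g"
    using T(2) unfolding Gab_eq by blast
  have "y = e + map_vec b g"
    unfolding b(2)[symmetric] using y(1) e(1) by (intro eq_vecI) auto
  then have "y \<cdot>\<^sub>2 T = e \<cdot>\<^sub>2 T + map_vec b g \<cdot>\<^sub>2 T"
    using add_vec_mult_F2[OF e(1) _ T(1), of "map_vec b g"] by simp
  \<comment> \<open>\<open>b\<close> commutes with the binary matrix and
    \<open>g \<cdot>\<^sub>2 T\<close> is \<open>s\<close> at \<open>g\<close>, so the codeword
    contained in \<open>y\<close> turns into a composition.\<close>
  also have "map_vec b g \<cdot>\<^sub>2 T = map_vec b (map_vec s g)"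
    unfolding s(2)[symmetric] using T(1)
    by (intro map_vec_vec_mult_F2[symmetric] additive_lin_maps[OF char2 b(1)]) simp
  finally have yT: "y \<cdot>\<^sub>2 T = e \<cdot>\<^sub>2 T + map_vec b (map_vec s g)" .
  have "map_vec V (e \<cdot>\<^sub>2 T) = map_vec V e \<cdot>\<^sub>2 T"
    using T(1) e(1) by (intro map_vec_vec_mult_F2[OF V_add]) simp
  also have "map_vec V e = 0\<^sub>v n"
    using min(3) e(1) by (intro eq_vecI) (simp_all add: vanishes_on_def V_def)
  finally have VeT: "map_vec V (e \<cdot>\<^sub>2 T) = 0\<^sub>v n"
    using zero_vec_mult_F2[OF T(1)] by simp
  have "map_vec V (g \<cdot>\<^sub>2 (S * P)) = map_vec V g \<cdot>\<^sub>2 (S * P)"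
    using SP by (intro map_vec_vec_mult_F2[OF V_add]) simp
  also have "\<dots> = g \<cdot>\<^sub>2 N"
    unfolding M(2)[symmetric] N_def using M(1) SP by (intro vec_mult_F2_assoc[OF char2]) simp_all
  finally have VgSP: "map_vec V (g \<cdot>\<^sub>2 (S * P)) = g \<cdot>\<^sub>2 N" .
  define c where "c = (\<lambda>z. (V \<circ> (b \<circ> s)) z + (V \<circ> a) z)"
  \<comment> \<open>The 2-degrees are at most \<open>k - 1\<close> for \<open>b\<close>,
    \<open>l\<close> for \<open>s\<close> and \<open>w\<close> for \<open>V\<close>;
    \<open>1 \<le> k\<close> lets \<open>k\<close> be written as a successor for
    \<open>lin_maps_comp\<close>.\<close>
  have "b \<circ> s \<in> lin_maps (k - 1 + (l + 1))"
    using b(1) s(1) k by (intro lin_maps_comp[OF char2]) simp_all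
  then have "V \<circ> (b \<circ> s) \<in> lin_maps (w + (k - 1 + (l + 1)))"
    by (rule lin_maps_comp[OF char2 V_lin])
  moreover have "w + (k - 1 + (l + 1)) = k + l + w"
    using k by simp
  ultimately have Vbs: "V \<circ> (b \<circ> s) \<in> lin_maps (k + l + w)"
    by (simp only:)
  have "V \<circ> a \<in> lin_maps (k + l + w)"
    using lin_maps_comp[OF char2 V_lin a(1)] lin_maps_mono[of "w + k" "k + l + w"] by auto
  with Vbs have "c \<in> lin_maps (k + l + w)"
    unfolding c_def by (rule lin_maps_add)
  then have c_Gab: "map_vec c g \<in> Gab (k + l + w) g"
    unfolding Gab_eq by blast
  have z: "map_vec V x = map_vec c g + g \<cdot>\<^sub>2 N"
  proof (rule eq_vecI)
    fix j
    assume "j < dim_vec (map_vec c g + g \<cdot>\<^sub>2 N)"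
    then have j: "j < n"
      using N by simp
    have "x $ j - q $ j = a (g $ j)"
      using arg_cong[OF a(2), of "\<lambda>v. v $ j"] j q by simp
    then have "x $ j = (y \<cdot>\<^sub>2 T) $ j + (g \<cdot>\<^sub>2 (S * P)) $ j + a (g $ j)"
      using j SP P(1) by (simp add: q_def algebra_simps)
    also have "(y \<cdot>\<^sub>2 T) $ j = (e \<cdot>\<^sub>2 T) $ j + b (s (g $ j))"
      unfolding yT using j by simp
    finally have "V (x $ j) = V ((e \<cdot>\<^sub>2 T) $ j) + V (b (s (g $ j)))
        + V ((g \<cdot>\<^sub>2 (S * P)) $ j) + V (a (g $ j))"
      by (simp only: additive.add[OF V_add])
    moreover have "V ((e \<cdot>\<^sub>2 T) $ j) = 0"
      using arg_cong[OF VeT, of "\<lambda>v. v $ j"] j T(1) by simp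
    moreover have "V ((g \<cdot>\<^sub>2 (S * P)) $ j) = (g \<cdot>\<^sub>2 N) $ j"
      using arg_cong[OF VgSP, of "\<lambda>v. v $ j"] j SP P(1) by simp
    ultimately show "map_vec V x $ j = (map_vec c g + g \<cdot>\<^sub>2 N) $ j"
      using j x(1) N by (simp add: c_def)
  qed (use x(1) N in simp)
  have inj: "P *\<^sub>v v = 0\<^sub>v n" if "v \<in> carrier_vec n" "N *\<^sub>v v = 0\<^sub>v n" for v
    using good[OF that(1)] that unfolding N_mult[OF that(1)] M_def V_def by blast
  \<comment> \<open>\<open>M\<close> after \<open>S\<close> is injective on the image of
    \<open>P\<close>, so \<open>N\<close> and \<open>P\<close> have ranges of the same size and
    hence the same rank.\<close>
  have "card ((*\<^sub>v) N ` carrier_vec n) = card ((*\<^sub>v) P ` carrier_vec n)"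
  proof -
    let ?h = "\<lambda>p. M *\<^sub>v (S *\<^sub>v p)"
    have "(*\<^sub>v) N ` carrier_vec n = ?h ` (*\<^sub>v) P ` carrier_vec n"
      unfolding image_image using N_mult by (rule image_cong[OF refl])
    moreover have "inj_on ?h ((*\<^sub>v) P ` carrier_vec n)"
    proof (rule inj_onI, clarify)
      fix u v :: "bit vec"
      assume u: "u \<in> carrier_vec n" and v: "v \<in> carrier_vec n"
        and eq: "?h (P *\<^sub>v u) = ?h (P *\<^sub>v v)"
      have "N *\<^sub>v (u - v) = N *\<^sub>v v - N *\<^sub>v v"
        unfolding mult_minus_distrib_mat_vec[OF N u v] using eq N_mult u v by simp
      also have "\<dots> = 0\<^sub>v n"
        by (rule minus_cancel_vec[OF mult_mat_vec_carrier[OF N v]])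
      finally have "P *\<^sub>v (u - v) = 0\<^sub>v n"
        by (rule inj[OF minus_carrier_vec[OF u v]])
      then have diff0: "P *\<^sub>v u - P *\<^sub>v v = 0\<^sub>v n"
        unfolding mult_minus_distrib_mat_vec[OF P(1) u v] .
      show "P *\<^sub>v u = P *\<^sub>v v"
      proof (rule eq_vecI)
        fix i
        assume "i < dim_vec (P *\<^sub>v v)"
        then have "i < n"
          using P(1) by simp
        then have "(P *\<^sub>v u) $ i - (P *\<^sub>v v) $ i = 0"
          using arg_cong[OF diff0, of "\<lambda>v. v $ i"] P(1) by (simp only: index_minus_vec
              index_zero_vec dim_mult_mat_vec carrier_matD)
        then show "(P *\<^sub>v u) $ i = (P *\<^sub>v v) $ i"
          by (simp only: right_minus_eq)
      qed simp
    qed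
    ultimately show ?thesis
      by (simp only: card_image)
  qed
  then have "2 ^ vec_space.rank n N = (2 :: nat) ^ t"
    unfolding card_range_mat[OF N] card_range_mat[OF P(1)] CARD_bit P(3) .
  then have "vec_space.rank n N = t"
    by simp
  then have rk: "rk g (g \<cdot>\<^sub>2 N) = t"
    unfolding rk_def dim_g Ext_vec_mult_F2[OF N] .
  \<comment> \<open>Row reduction keeps the kernel of \<open>N\<close>, which is that of
    \<open>P\<close>, and a reduced form is determined by its kernel.\<close>
  have "gauss_jordan_single N = P"
  proof (rule row_echelon_form_unique)
    note gj = gauss_jordan_single[OF N refl]
    show "gauss_jordan_single N \<in> carrier_mat n n" "row_echelon_form (gauss_jordan_single N)"
      by (rule gj)+
    show "P \<in> carrier_mat n n" "row_echelon_form P"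
      by (rule P)+
    fix v :: "bit vec"
    assume v: "v \<in> carrier_vec n"
    have "N *\<^sub>v v = 0\<^sub>v n" if "P *\<^sub>v v = 0\<^sub>v n"
    proof -
      have zero: "A *\<^sub>v 0\<^sub>v n = 0\<^sub>v n" if "A \<in> carrier_mat n n" for A :: "bit mat"
        using that by (intro eq_vecI) auto
      show ?thesis
        unfolding N_mult[OF v] that zero[OF S] by (rule zero[OF M(1)])
    qed
    then show "gauss_jordan_single N *\<^sub>v v = 0\<^sub>v n \<longleftrightarrow> P *\<^sub>v v = 0\<^sub>v n"
      using gj(1)[OF v] inj[OF v] by blast
  qed
  \<comment> \<open>The error has rank exactly \<open>t\<close>, so the decoder corrects it and the
    test for rank below \<open>t\<close> does not reject it.\<close>
  moreover have "D (map_vec V x) = Some (g \<cdot>\<^sub>2 N)"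
    unfolding z
    using D[unfolded corrects_errors_def dim_g, rule_format, OF c_Gab vec_mult_F2_carrier[OF N, of g]] rk
    by simp
  ultimately show ?thesis
    unfolding Decrypt_def Let_def q_def[symmetric] x_def[symmetric] V_def[symmetric]
    by (simp add: rk Ext_vec_mult_F2[OF N])
qed

end

section \<open>Averaging over the random choices and the final bound\<close>

lemma measure_bind_pmf_le:
  assumes "\<And>x. x \<in> set_pmf p \<Longrightarrow> measure_pmf.prob (f x) A \<le> c" "0 \<le> c"
  shows "measure_pmf.prob (bind_pmf p f) A \<le> c"
proof -
  have "emeasure (bind_pmf p f) A = (\<integral>\<^sup>+x. emeasure (f x) A \<partial>p)"
    by simp
  also have "\<dots> \<le> (\<integral>\<^sup>+x. ennreal c \<partial>p)"
    using assms(1)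
    by (intro nn_integral_mono_AE)
      (auto simp: AE_measure_pmf_iff measure_pmf.emeasure_eq_measure intro: ennreal_leI)
  also have "\<dots> = ennreal c"
    by simp
  finally show ?thesis
    using assms(2) by (simp add: measure_pmf.emeasure_eq_measure)
qed

text \<open>Clearing denominators leaves \<open>a * b \<le> m * (a + b - 1)\<close>, which follows
  from \<open>a \<le> m\<close> and \<open>b \<le> a + b - 1\<close>. It is applied to 2^t, 2^w and
  2^n.\<close>

lemma product_ratio_le:
  fixes a b m :: real
  assumes "1 \<le> a" "1 \<le> b" "a \<le> m" "1 < m"
  shows "(a - 1) * (b - 1) / (m - 1) \<le> a * b / m"
proof -
  have "a * b \<le> m * b"
    using assms by (intro mult_right_mono) auto
  also have "\<dots> \<le> m * (a + b - 1)"
    using assms by (intro mult_left_mono) auto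
  finally have "(a - 1) * (b - 1) * m \<le> a * b * (m - 1)"
    by (simp add: algebra_simps)
  then show ?thesis
    using assms by (simp add: field_simps)
qed

theorem lemma3:
  fixes n k w l t :: nat
    and g :: "'a::{field,finite} vec"
    and H :: "'a mat"
    and kpub kpriv :: "'a vec"
    and Y :: "'a vec \<Rightarrow> 'a vec pmf"
    and X :: "'a vec \<Rightarrow> 'a vec"
    and D :: "'a vec \<Rightarrow> 'a vec option"
    and P :: "bit mat"
  assumes "n \<ge> 1" and "k \<ge> 1" and "w \<ge> 1" and "l \<ge> 1" and "t \<ge> 1"
    and "int t = \<lfloor>(real n - real k - real l - real w) / 2\<rfloor>"
    and "CARD('a) = 2 ^ n"
    and "ordered_basis n g"
    and "parity_check n k g H"
    and "(kpub, kpriv) \<in> set_pmf (KeyGen g H w)"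
    and "solution_sampler H Y"
    and "solver H X"
    and "corrects_errors g (Gab (k + l + w) g) t D"
    and "P \<in> RREF_mats t n"
  shows "measure_pmf.prob
           (do {u \<leftarrow> Encrypt g H l Y kpub P; return_pmf (Decrypt g t X D kpriv u)})
           {Phat. Phat \<noteq> Some P}
         \<le> 2 powr (- (real n - real t - real w))"
proof -
  interpret F2_basis n g
    using assms(7,8) by unfold_locales
  have "real t \<le> (real n - real k - real l - real w) / 2"
    using assms(6) by linarith
  then have le: "real t + real k + real l + real w \<le> real n"
    by simp
  \<comment> \<open>\<open>w \<le> n\<close> and \<open>l < n\<close>, the latter strict by
    \<open>k \<ge> 1\<close>, make the sets from which the private key and \<open>T\<close> are
    drawn nonempty.\<close>
  have "t \<le> n" "w \<le> n" "l < n"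
    using le assms(2) by linarith+
  have H: "H \<in> carrier_mat (n - k) n" "Gab k g = mat_kernel H"
    using assms(9) by (simp_all add: parity_check_def)
  have P: "P \<in> carrier_mat n n" "vec_space.rank n P = t"
    using assms(14) by (simp_all add: RREF_mats_def)
  let ?E = "{e \<in> carrier_vec (dim_vec g). rk g e = w}"
  have "?E \<noteq> {}" "finite ?E"
    using ex_rk[OF \<open>w \<le> n\<close>] by auto
  then have e: "kpriv \<in> carrier_vec n" "rk g kpriv = w" "kpub = H *\<^sub>v kpriv"
    using assms(10) by (auto simp: KeyGen_def)
  let ?M = "Ext g (map_vec (poly (min_vanishing_poly kpriv)) g)"
  \<comment> \<open>Zero is removed from both sets because an invertible matrix sends nonzero
    vectors to nonzero vectors; this gives the factors 2^t - 1 and 2^w - 1.\<close>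
  define X' where "X' = (*\<^sub>v) P ` carrier_vec n - {0\<^sub>v n}"
  define K where "K = {v \<in> carrier_vec n. ?M *\<^sub>v v = 0\<^sub>v n} - {0\<^sub>v n}"
  define bad where "bad = {S \<in> GL n. \<exists>x\<in>X'. S *\<^sub>v x \<in> K}"
  have M: "?M \<in> carrier_mat n n"
    by (rule Ext) simp
  have zero: "A *\<^sub>v 0\<^sub>v n = 0\<^sub>v n" if "A \<in> carrier_mat n n" for A :: "bit mat"
    using that by (intro eq_vecI) auto
  have "0\<^sub>v n \<in> (*\<^sub>v) P ` carrier_vec n"
    by (rule image_eqI[of _ _ "0\<^sub>v n"]) (simp_all add: zero[OF P(1)])
  then have cX: "card X' = 2 ^ t - 1"
    unfolding X'_def by (simp add: card_Diff_singleton card_range_mat[OF P(1)] CARD_bit P(2))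
  have cK: "card K \<le> 2 ^ w - 1"
    unfolding K_def using card_kernel_min_vanishing_poly[OF e(1,2)]
    by (simp add: card_Diff_singleton zero[OF M])
  have sub: "X' \<subseteq> carrier_vec n - {0\<^sub>v n}" "K \<subseteq> carrier_vec n - {0\<^sub>v n}"
    using mult_mat_vec_carrier[OF P(1)] unfolding X'_def K_def by blast+
  have GL_pos: "0 < card (GL n :: bit mat set)"
    using GL_nonempty by (simp add: card_gt_0_iff)
  have "card X' * card K \<le> (2 ^ t - 1) * (2 ^ w - 1)"
    unfolding cX by (rule mult_le_mono2[OF cK])
  then have "(2 ^ n - 1) * card bad \<le> (2 ^ t - 1) * (2 ^ w - 1) * card (GL n :: bit mat set)"
    using card_GL_meets_le[OF sub] unfolding bad_def by (rule le_trans[rotated, OF mult_le_mono1])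
  then have "real ((2 ^ n - 1) * card bad) \<le> real ((2 ^ t - 1) * (2 ^ w - 1) * card (GL n :: bit mat set))"
    by (simp only: of_nat_le_iff)
  then have "(2 ^ n - 1) * real (card bad) \<le> (2 ^ t - 1) * (2 ^ w - 1) * real (card (GL n :: bit mat set))"
    by (simp add: of_nat_diff)
  moreover have frac: "x / c \<le> p / a" if "a * x \<le> p * c" "0 < a" "0 < c" for a c p x :: real
    using that by (simp add: field_simps)
  moreover have n: "1 < (2 :: real) ^ n"
    using assms(1) by simp
  ultimately have "real (card bad) / real (card (GL n :: bit mat set)) \<le> (2 ^ t - 1) * (2 ^ w - 1) / (2 ^ n - 1)"
    using GL_pos by (intro frac) simp_all
  also have "\<dots> \<le> 2 ^ t * 2 ^ w / 2 ^ n"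
    using n \<open>t \<le> n\<close> by (intro product_ratio_le) simp_all
  also have "\<dots> = 2 powr (- (real n - real t - real w))"
    by (simp add: powr_add powr_diff powr_realpow)
  finally have bound: "real (card bad) / real (card (GL n :: bit mat set)) \<le> 2 powr (- (real n - real t - real w))" .
  have "finite (mats_of_gdeg g l)"
    by (rule finite_subset[OF _ finite_carrier_mat[of n n]]) (auto simp: mats_of_gdeg_def)
  note set_T = set_pmf_of_set[OF mats_of_gdeg_nonempty[OF \<open>l < n\<close>] this]
  have GL_eq: "{S \<in> carrier_mat (dim_vec g) (dim_vec g). invertible_mat S} = (GL n :: bit mat set)"
    by (simp add: GL_def)
  \<comment> \<open>With \<open>y\<close> and \<open>T\<close> fixed, \<open>S\<close> alone is
    random, and \<open>bad\<close> depends on neither of them, so the bound is uniform in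
    both.\<close>
  have "measure_pmf.prob
      (map_pmf (\<lambda>S. Decrypt g t X D kpriv (H *\<^sub>v (y \<cdot>\<^sub>2 T + g \<cdot>\<^sub>2 (S * P)))) (pmf_of_set (GL n)))
      {Phat. Phat \<noteq> Some P} \<le> 2 powr (- (real n - real t - real w))"
    if y: "y \<in> set_pmf (Y kpub)" and T: "T \<in> set_pmf (pmf_of_set (mats_of_gdeg g l))" for y T
  proof -
    have "kpub \<in> carrier_vec (dim_row H)"
      unfolding e(3) using mult_mat_vec_carrier[OF H(1) e(1)] H(1) by simp
    then have y: "y \<in> carrier_vec n" "H *\<^sub>v y = H *\<^sub>v kpriv"
      using y assms(11) H(1) e(3) unfolding solution_sampler_def by auto
    have T: "T \<in> mats_of_gdeg g l"
      using T set_T by simp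
    let ?dec = "\<lambda>S. Decrypt g t X D kpriv (H *\<^sub>v (y \<cdot>\<^sub>2 T + g \<cdot>\<^sub>2 (S * P)))"
    have "?dec S = Some P" if S: "S \<in> GL n" "S \<notin> bad" for S
    proof (rule Decrypt_eq[OF assms(2) H e(1,2) y assms(12,13,14) T])
      show S_carrier: "S \<in> carrier_mat n n"
        using S(1) by (simp add: GL_def)
      fix v :: "bit vec"
      assume v: "v \<in> carrier_vec n" "P *\<^sub>v v \<noteq> 0\<^sub>v n"
      have Pv: "P *\<^sub>v v \<in> carrier_vec n"
        by (rule mult_mat_vec_carrier[OF P(1) v(1)])
      have "P *\<^sub>v v \<in> X'"
        using v unfolding X'_def by blast
      then have "S *\<^sub>v (P *\<^sub>v v) \<notin> K"
        using S unfolding bad_def by blast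
      then show "?M *\<^sub>v (S *\<^sub>v (P *\<^sub>v v)) \<noteq> 0\<^sub>v n"
        using GL_mult_vec_nonzero[OF S(1) Pv v(2)] mult_mat_vec_carrier[OF S_carrier Pv]
        unfolding K_def by blast
    qed
    then have "GL n \<inter> ?dec -` {Phat. Phat \<noteq> Some P} \<subseteq> bad"
      by blast
    moreover have "finite bad"
      unfolding bad_def by simp
    ultimately have "card (GL n \<inter> ?dec -` {Phat. Phat \<noteq> Some P}) \<le> card bad"
      by (intro card_mono)
    then have "measure_pmf.prob (map_pmf ?dec (pmf_of_set (GL n))) {Phat. Phat \<noteq> Some P}
        \<le> real (card bad) / real (card (GL n :: bit mat set))"
      by (simp add: measure_pmf_of_set[OF GL_nonempty finite_GL] divide_right_mono)
    then show ?thesis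
      using bound by simp
  qed
  note step = this[unfolded map_pmf_def]
  \<comment> \<open>A bound valid for every outcome of \<open>y\<close> and \<open>T\<close>
    survives averaging over both.\<close>
  show ?thesis
    unfolding Encrypt_def Let_def bind_assoc_pmf bind_return_pmf GL_eq
    by (rule measure_bind_pmf_le, rule measure_bind_pmf_le, rule step) (assumption | simp)+
qed

end
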